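(* Let $\xi\in\mathbb C/2\mathbb Z$ and $\tau\in\mathbb C$ be arbitrary, and fix a square root $\sqrt\tau$. The dense $\mathfrak{sl}(2)$-module $\mathbb V(\xi,\tau)$ does not admit a compatible structure of $\mathbf{Witt}_{<}$-module if and only if the roots of the polynomial $(x-1)^2-\tau$ (that is, both $1+\sqrt\tau$ and $1-\sqrt\tau$) lie in $\xi$. For each choice of sign, if the root $1\mp\sqrt\tau$ does not lie in $\xi$, then $\mathbb V(\xi,\tau)$ is a $\mathbf{Witt}_{<}$-module (compatibly with its $\mathfrak{sl}(2)$-structure) via $$\rho_{<}^{\pm}(L_i)v_\mu=\Big(\frac{(-1)^i}{2}\big(i(\pm\sqrt\tau-1)-\mu\big)\,P\big(\tfrac12(1+\mu\pm\sqrt\tau),i\big)\Big)v_{\mu+2i},\qquad i\le1,\ \mu\in\xi.$$ In particular, if $\mathbb V(\xi,\tau)$ is simple, then it carries exactly two compatible $\mathbf{Witt}_{<}$-module structures for $\tau\ne0,1$ and exactly one for $\tau=0,1$.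
   Context: $\mathfrak{sl}(2)=\mathfrak{sl}(2,\mathbb C)$ has Chevalley basis $\{e,f,h\}$ with $[e,f]=h$, $[h,e]=2e$, $[h,f]=-2f$. $\mathbf{Witt}_{<}$ is the complex Lie algebra with basis $\{L_k\}_{k\le1}$ and bracket $[L_i,L_j]=(i-j)L_{i+j}$; $\mathfrak{sl}(2)$ is embedded in it by $f\mapsto L_{-1}$, $h\mapsto-2L_0$, $e\mapsto-L_1$, and a $\mathbf{Witt}_{<}$-module structure on an $\mathfrak{sl}(2)$-module is compatible if its restriction along this embedding is the given $\mathfrak{sl}(2)$-structure. A class $\xi\in\mathbb C/2\mathbb Z$ is regarded as a subset of $\mathbb C$. The dense module $\mathbb V(\xi,\tau)$ is the vector space with basis $\{v_\mu:\mu\in\xi\}$ and action $f v_\mu=v_{\mu-2}$, $h v_\mu=\mu v_\mu$, $e v_\mu=\frac14(\tau-(\mu+1)^2)v_{\mu+2}$; it is simple if and only if $\tau\neq(\mu+1)^2$ for all $\mu\in\xi$. The Pochhammer symbol is $P(z,n)=z(z+1)\cdots(z+n-1)$ for $n\ge0$ and $P(z,n)=\frac1{(z+n)(z+n+1)\cdots(z-1)}$ for $n\le-1$. *)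

theory Defs
  imports "HOL-Analysis.Analysis" "HOL-Library.Poly_Mapping" "HOL-Library.FuncSet"
begin

section \<open>Lie algebras and their modules on carrier sets\<close>

locale lie_algebra_on = vector_space scale
  for scale :: "'k::field \<Rightarrow> 'g::ab_group_add \<Rightarrow> 'g" +
  fixes \<g> :: "'g set" and br :: "'g \<Rightarrow> 'g \<Rightarrow> 'g"
  assumes lie_subspace: "subspace \<g>"
    and br_closed: "\<lbrakk>x \<in> \<g>; y \<in> \<g>\<rbrakk> \<Longrightarrow> br x y \<in> \<g>"
    and br_add_left: "\<lbrakk>x \<in> \<g>; y \<in> \<g>; z \<in> \<g>\<rbrakk> \<Longrightarrow> br (x + y) z = br x z + br y z"
    and br_add_right: "\<lbrakk>x \<in> \<g>; y \<in> \<g>; z \<in> \<g>\<rbrakk> \<Longrightarrow> br x (y + z) = br x y + br x z"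
    and br_scale_left: "\<lbrakk>x \<in> \<g>; y \<in> \<g>\<rbrakk> \<Longrightarrow> br (scale c x) y = scale c (br x y)"
    and br_scale_right: "\<lbrakk>x \<in> \<g>; y \<in> \<g>\<rbrakk> \<Longrightarrow> br x (scale c y) = scale c (br x y)"
    and br_alternating: "x \<in> \<g> \<Longrightarrow> br x x = 0"
    and br_jacobi: "\<lbrakk>x \<in> \<g>; y \<in> \<g>; z \<in> \<g>\<rbrakk> \<Longrightarrow> br x (br y z) + br y (br z x) + br z (br x y) = 0"

text \<open>Actions are required to be extensional functions on the carriers, so that two module
  structures are equal in HOL exactly if they agree on the carriers, and can be counted.\<close>

locale lie_module_on = lie_algebra_on scale \<g> br + V: vector_space scaleV
  for scale :: "'k::field \<Rightarrow> 'g::ab_group_add \<Rightarrow> 'g" and \<g> br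
    and scaleV :: "'k \<Rightarrow> 'v::ab_group_add \<Rightarrow> 'v" +
  fixes V :: "'v set" and \<rho> :: "'g \<Rightarrow> 'v \<Rightarrow> 'v"
  assumes module_subspace: "V.subspace V"
    and act_funcset: "\<rho> \<in> \<g> \<rightarrow>\<^sub>E (V \<rightarrow>\<^sub>E V)"
    and act_add_left: "\<lbrakk>x \<in> \<g>; y \<in> \<g>; v \<in> V\<rbrakk> \<Longrightarrow> \<rho> (x + y) v = \<rho> x v + \<rho> y v"
    and act_add_right: "\<lbrakk>x \<in> \<g>; v \<in> V; w \<in> V\<rbrakk> \<Longrightarrow> \<rho> x (v + w) = \<rho> x v + \<rho> x w"
    and act_scale_left: "\<lbrakk>x \<in> \<g>; v \<in> V\<rbrakk> \<Longrightarrow> \<rho> (scale c x) v = scaleV c (\<rho> x v)"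
    and act_scale_right: "\<lbrakk>x \<in> \<g>; v \<in> V\<rbrakk> \<Longrightarrow> \<rho> x (scaleV c v) = scaleV c (\<rho> x v)"
    and act_br: "\<lbrakk>x \<in> \<g>; y \<in> \<g>; v \<in> V\<rbrakk> \<Longrightarrow> \<rho> (br x y) v = \<rho> x (\<rho> y v) - \<rho> y (\<rho> x v)"

locale simple_lie_module_on = lie_module_on +
  assumes module_nontrivial: "V \<noteq> {0}"
    and submodule_trivial:
      "\<lbrakk>V.subspace W; W \<subseteq> V; \<And>x w. \<lbrakk>x \<in> \<g>; w \<in> W\<rbrakk> \<Longrightarrow> \<rho> x w \<in> W\<rbrakk> \<Longrightarrow> W = {0} \<or> W = V"


section \<open>Complex vector spaces with a given basis\<close>

text \<open>The complex vector space with basis \<open>I\<close> is realised as the set \<open>free_space I\<close> of finitely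
  supported functions with support in \<open>I\<close>; the basis vector of index \<open>i\<close> is
  \<open>Poly_Mapping.single i 1\<close>.\<close>

definition pm_scale :: "complex \<Rightarrow> ('i \<Rightarrow>\<^sub>0 complex) \<Rightarrow> ('i \<Rightarrow>\<^sub>0 complex)" where
  "pm_scale c = Poly_Mapping.map ((*) c)"

definition free_space :: "'i set \<Rightarrow> ('i \<Rightarrow>\<^sub>0 complex) set" where
  "free_space I = {p. Poly_Mapping.keys p \<subseteq> I}"

definition lin_ext :: "('i \<Rightarrow> 'j \<Rightarrow>\<^sub>0 complex) \<Rightarrow> ('i \<Rightarrow>\<^sub>0 complex) \<Rightarrow> ('j \<Rightarrow>\<^sub>0 complex)" where
  "lin_ext b p = (\<Sum>i\<in>Poly_Mapping.keys p. pm_scale (Poly_Mapping.lookup p i) (b i))"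


section \<open>The Lie algebras and the dense modules\<close>

definition mat_scale :: "complex \<Rightarrow> complex^2^2 \<Rightarrow> complex^2^2" where
  "mat_scale c A = (\<chi> i j. c * A $ i $ j)"

definition sl2 :: "(complex^2^2) set" where
  "sl2 = {A. trace A = 0}"

definition sl2_br :: "complex^2^2 \<Rightarrow> complex^2^2 \<Rightarrow> complex^2^2" where
  "sl2_br A B = A ** B - B ** A"

definition sl2_e :: "complex^2^2" where "sl2_e = vector [vector [0, 1], vector [0, 0]]"
definition sl2_f :: "complex^2^2" where "sl2_f = vector [vector [0, 0], vector [1, 0]]"
definition sl2_h :: "complex^2^2" where "sl2_h = vector [vector [1, 0], vector [0, -1]]"

definition witt :: "(int \<Rightarrow>\<^sub>0 complex) set" where
  "witt = free_space {..1}"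

definition witt_L :: "int \<Rightarrow> (int \<Rightarrow>\<^sub>0 complex)" where
  "witt_L k = Poly_Mapping.single k 1"

text \<open>On \<open>int \<Rightarrow>\<^sub>0 complex\<close> this is the bracket of the full Witt algebra; it restricts to \<open>witt\<close>
  because the coefficient of \<open>[L\<^sub>1, L\<^sub>1]\<close> vanishes.\<close>

definition witt_br :: "(int \<Rightarrow>\<^sub>0 complex) \<Rightarrow> (int \<Rightarrow>\<^sub>0 complex) \<Rightarrow> (int \<Rightarrow>\<^sub>0 complex)" where
  "witt_br x y =
     lin_ext (\<lambda>i. lin_ext (\<lambda>j. pm_scale (of_int (i - j)) (witt_L (i + j))) y) x"

text \<open>The linear maps below use that \<open>A \<in> sl2\<close> has coordinates \<open>A $ 1 $ 2\<close>, \<open>A $ 2 $ 1\<close> and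
  \<open>A $ 1 $ 1\<close> with respect to \<open>e\<close>, \<open>f\<close> and \<open>h\<close>.\<close>

definition sl2_to_witt :: "complex^2^2 \<Rightarrow> (int \<Rightarrow>\<^sub>0 complex)" where
  "sl2_to_witt A =
     pm_scale (A $ 1 $ 2) (- witt_L 1) + pm_scale (A $ 2 $ 1) (witt_L (- 1))
     + pm_scale (A $ 1 $ 1) (pm_scale (- 2) (witt_L 0))"

definition cong_2Z :: "(complex \<times> complex) set" where
  "cong_2Z = {(x, y). \<exists>k::int. x - y = 2 * of_int k}"

definition dense_v :: "complex \<Rightarrow> (complex \<Rightarrow>\<^sub>0 complex)" where
  "dense_v \<mu> = Poly_Mapping.single \<mu> 1"

definition dense_e :: "complex \<Rightarrow> (complex \<Rightarrow>\<^sub>0 complex) \<Rightarrow> (complex \<Rightarrow>\<^sub>0 complex)" where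
  "dense_e \<tau> = lin_ext (\<lambda>\<mu>. pm_scale (1/4 * (\<tau> - (\<mu> + 1)\<^sup>2)) (dense_v (\<mu> + 2)))"

definition dense_f :: "(complex \<Rightarrow>\<^sub>0 complex) \<Rightarrow> (complex \<Rightarrow>\<^sub>0 complex)" where
  "dense_f = lin_ext (\<lambda>\<mu>. dense_v (\<mu> - 2))"

definition dense_h :: "(complex \<Rightarrow>\<^sub>0 complex) \<Rightarrow> (complex \<Rightarrow>\<^sub>0 complex)" where
  "dense_h = lin_ext (\<lambda>\<mu>. pm_scale \<mu> (dense_v \<mu>))"

definition dense_act ::
    "complex set \<Rightarrow> complex \<Rightarrow> complex^2^2 \<Rightarrow> (complex \<Rightarrow>\<^sub>0 complex) \<Rightarrow> (complex \<Rightarrow>\<^sub>0 complex)" where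
  "dense_act \<xi> \<tau> = (\<lambda>A\<in>sl2. \<lambda>v\<in>free_space \<xi>.
     pm_scale (A $ 1 $ 2) (dense_e \<tau> v) + pm_scale (A $ 2 $ 1) (dense_f v)
     + pm_scale (A $ 1 $ 1) (dense_h v))"

definition compatible_witt_structures ::
    "complex set \<Rightarrow> complex \<Rightarrow>
      ((int \<Rightarrow>\<^sub>0 complex) \<Rightarrow> (complex \<Rightarrow>\<^sub>0 complex) \<Rightarrow> (complex \<Rightarrow>\<^sub>0 complex)) set" where
  "compatible_witt_structures \<xi> \<tau> = {\<rho>.
     lie_module_on pm_scale witt witt_br pm_scale (free_space \<xi>) \<rho> \<and>
     (\<forall>A\<in>sl2. \<forall>v\<in>free_space \<xi>. \<rho> (sl2_to_witt A) v = dense_act \<xi> \<tau> A v)}"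

definition simple_dense :: "complex set \<Rightarrow> complex \<Rightarrow> bool" where
  "simple_dense \<xi> \<tau> \<longleftrightarrow>
     simple_lie_module_on mat_scale sl2 sl2_br pm_scale (free_space \<xi>) (dense_act \<xi> \<tau>)"

text \<open>For \<open>n < 0\<close> the product \<open>(z + n) (z + n + 1) \<dots> (z - 1)\<close> is the rising factorial of
  \<open>z + n\<close> with \<open>- n\<close> factors.\<close>

definition int_pochhammer :: "complex \<Rightarrow> int \<Rightarrow> complex" where
  "int_pochhammer z n =
     (if n \<ge> 0 then pochhammer z (nat n) else 1 / pochhammer (z + of_int n) (nat (- n)))"


section \<open>The objects above are what they should be\<close>

lemma lookup_pm_scale [simp]: "Poly_Mapping.lookup (pm_scale c p) i = c * Poly_Mapping.lookup p i"
  unfolding pm_scale_def by (simp add: Poly_Mapping.map.rep_eq when_def)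

lemma vector_space_pm_scale: "vector_space (pm_scale :: complex \<Rightarrow> ('i \<Rightarrow>\<^sub>0 complex) \<Rightarrow> _)"
  by unfold_locales (auto intro!: poly_mapping_eqI simp: lookup_add algebra_simps)

interpretation pm: vector_space pm_scale
  by (rule vector_space_pm_scale)

lemma vector_space_mat_scale: "vector_space mat_scale"
  by unfold_locales (auto simp: mat_scale_def vec_eq_iff algebra_simps)

lemma lin_ext_superset:
  assumes "finite S" "Poly_Mapping.keys p \<subseteq> S"
  shows "lin_ext b p = (\<Sum>i\<in>S. pm_scale (Poly_Mapping.lookup p i) (b i))"
  unfolding lin_ext_def using assms
  by (intro sum.mono_neutral_left) (auto simp: in_keys_iff)

lemma lin_ext_add [simp]: "lin_ext b (p + q) = lin_ext b p + lin_ext b q"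
proof -
  let ?S = "Poly_Mapping.keys p \<union> Poly_Mapping.keys q"
  have "Poly_Mapping.keys (p + q) \<subseteq> ?S" by (rule keys_add)
  then show ?thesis
    by (simp add: lin_ext_superset[of ?S] lookup_add pm.scale_left_distrib sum.distrib)
qed

lemma lin_ext_scale [simp]: "lin_ext b (pm_scale c p) = pm_scale c (lin_ext b p)"
proof -
  have "Poly_Mapping.keys (pm_scale c p) \<subseteq> Poly_Mapping.keys p"
    by (auto simp: in_keys_iff)
  then show ?thesis
    by (simp add: lin_ext_superset[of "Poly_Mapping.keys p"] pm.scale_sum_right)
qed

lemma lin_ext_zero [simp]: "lin_ext b 0 = 0"
  by (simp add: lin_ext_def)

lemma lin_ext_minus [simp]: "lin_ext b (- p) = - lin_ext b p"
proof -
  have "lin_ext b (- p) + lin_ext b p = 0" by (simp flip: lin_ext_add)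
  then show ?thesis by (simp add: eq_neg_iff_add_eq_0)
qed

lemma lin_ext_diff [simp]: "lin_ext b (p - q) = lin_ext b p - lin_ext b q"
  using lin_ext_add[of b p "- q"] by simp

lemma lin_ext_single [simp]: "lin_ext b (Poly_Mapping.single i c) = pm_scale c (b i)"
  by (cases "c = 0") (auto simp: lin_ext_def)

lemma lin_ext_add_fun: "lin_ext (\<lambda>i. b i + b' i) p = lin_ext b p + lin_ext b' p"
  by (simp add: lin_ext_def pm.scale_right_distrib sum.distrib)

lemma lin_ext_scale_fun: "lin_ext (\<lambda>i. pm_scale c (b i)) p = pm_scale c (lin_ext b p)"
  by (simp add: lin_ext_def pm.scale_sum_right mult.commute)

lemma pm_scale_single: "pm_scale c (Poly_Mapping.single i d) = Poly_Mapping.single i (c * d)"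
  by (rule poly_mapping_eqI) (simp add: lookup_single when_def)

lemma free_space_iff: "p \<in> free_space I \<longleftrightarrow> (\<forall>i. i \<notin> I \<longrightarrow> Poly_Mapping.lookup p i = 0)"
  by (auto simp: free_space_def in_keys_iff)

lemma subspace_free_space: "pm.subspace (free_space I)"
  by (simp add: pm.subspace_def free_space_iff lookup_add)

lemma lin_ext_in_free_space:
  assumes "p \<in> free_space I" "\<And>i. i \<in> I \<Longrightarrow> b i \<in> free_space J"
  shows "lin_ext b p \<in> free_space J"
  unfolding lin_ext_def using assms subspace_free_space[of J]
  by (intro pm.subspace_sum pm.subspace_scale) (auto simp: free_space_def)

lemma pm_induct [case_names basis scale add]:
  assumes "\<And>i. P (Poly_Mapping.single i 1)"
    and "\<And>c p. P p \<Longrightarrow> P (pm_scale c p)"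
    and "\<And>p q. P p \<Longrightarrow> P q \<Longrightarrow> P (p + q)"
  shows "P (p :: 'i \<Rightarrow>\<^sub>0 complex)"
proof -
  have P0: "P 0" using assms(2)[OF assms(1), of 0 undefined] by simp
  have "P (\<Sum>i\<in>S. pm_scale (Poly_Mapping.lookup p i) (Poly_Mapping.single i 1))"
    if "finite S" for S
    using that
    by (induction S rule: finite_induct) (simp_all add: P0 assms)
  moreover have "(\<Sum>i\<in>Poly_Mapping.keys p.
      pm_scale (Poly_Mapping.lookup p i) (Poly_Mapping.single i 1)) = p"
    by (rule poly_mapping_eqI)
      (auto simp: lookup_sum lookup_single when_def in_keys_iff if_distrib sum.delta cong: if_cong)
  ultimately show ?thesis by (metis finite_keys)
qed

lemma witt_br_add_left: "witt_br (x + y) z = witt_br x z + witt_br y z"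
  and witt_br_add_right: "witt_br x (y + z) = witt_br x y + witt_br x z"
  and witt_br_scale_left: "witt_br (pm_scale c x) y = pm_scale c (witt_br x y)"
  and witt_br_scale_right: "witt_br x (pm_scale c y) = pm_scale c (witt_br x y)"
  by (simp_all add: witt_br_def lin_ext_add_fun lin_ext_scale_fun)

lemmas witt_br_linear =
  witt_br_add_left witt_br_add_right witt_br_scale_left witt_br_scale_right

lemma witt_br_L: "witt_br (witt_L i) (witt_L j) = pm_scale (of_int (i - j)) (witt_L (i + j))"
  by (simp add: witt_br_def witt_L_def)

lemma witt_br_skew: "witt_br x y = - witt_br y x"
proof (induction x rule: pm_induct)
  case (basis i)
  show ?case
  proof (induction y rule: pm_induct)
    case (basis j)
    show ?case
      using witt_br_L[of i j] witt_br_L[of j i]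
      by (simp add: witt_L_def pm_scale_single add.commute flip: single_uminus)
  qed (simp_all add: witt_br_linear pm.scale_right_distrib)
qed (simp_all add: witt_br_linear)

lemma witt_br_jacobi:
  "witt_br x (witt_br y z) + witt_br y (witt_br z x) + witt_br z (witt_br x y) = 0"
proof -
  define J where "J x y z =
    witt_br x (witt_br y z) + witt_br y (witt_br z x) + witt_br z (witt_br x y)" for x y z
  have J_scale: "J (pm_scale c x) y z = pm_scale c (J x y z)"
    "J x (pm_scale c y) z = pm_scale c (J x y z)"
    "J x y (pm_scale c z) = pm_scale c (J x y z)" for c x y z
    by (simp_all add: J_def witt_br_linear pm.scale_right_distrib)
  have J_add: "J (x + x') y z = J x y z + J x' y z" "J x (y + y') z = J x y z + J x y' z"
    "J x y (z + z') = J x y z + J x y z'" for x x' y y' z z'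
    by (simp_all add: J_def witt_br_linear)
  have J_L: "J (witt_L i) (witt_L j) (witt_L k) = 0" for i j k
  proof -
    have "J (witt_L i) (witt_L j) (witt_L k) =
      pm_scale (of_int ((j - k) * (i - (j + k)) + (k - i) * (j - (k + i)) + (i - j) * (k - (i + j))))
        (witt_L (i + j + k))"
      by (simp add: J_def witt_br_L witt_br_linear pm.scale_left_distrib ac_simps)
    also have "(j - k) * (i - (j + k)) + (k - i) * (j - (k + i)) + (i - j) * (k - (i + j)) = 0"
      by (simp add: algebra_simps)
    finally show ?thesis by simp
  qed
  have "J (witt_L i) (witt_L j) z = 0" for i j
    by (induction z rule: pm_induct) (simp_all add: J_L[unfolded witt_L_def] J_scale J_add witt_L_def)
  then have "J (witt_L i) y z = 0" for i
    by (induction y rule: pm_induct) (simp_all add: J_scale J_add witt_L_def)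
  then have "J x y z = 0"
    by (induction x rule: pm_induct) (simp_all add: J_scale J_add witt_L_def)
  then show ?thesis by (simp add: J_def)
qed

lemma witt_br_closed:
  assumes "x \<in> witt" "y \<in> witt"
  shows "witt_br x y \<in> witt"
  using assms unfolding witt_br_def witt_def
  by (intro lin_ext_in_free_space[of x "{..1}"] lin_ext_in_free_space[of y "{..1}"])
    (auto simp: free_space_def witt_L_def pm_scale_single)

lemma lie_algebra_witt: "lie_algebra_on pm_scale witt witt_br"
proof
  show "pm.subspace witt" by (simp add: witt_def subspace_free_space)
  show "witt_br x x = 0" for x
  proof (rule poly_mapping_eqI)
    fix i
    have "Poly_Mapping.lookup (witt_br x x) i = - Poly_Mapping.lookup (witt_br x x) i"
      using witt_br_skew[of x x] by (metis lookup_uminus)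
    then show "Poly_Mapping.lookup (witt_br x x) i = Poly_Mapping.lookup 0 i"
      by simp
  qed
qed (simp_all add: witt_br_closed witt_br_linear witt_br_jacobi)

lemma mat2_eq_iff: "A = B \<longleftrightarrow> A $ 1 $ 1 = B $ 1 $ 1 \<and> A $ 1 $ 2 = B $ 1 $ 2 \<and>
    A $ 2 $ 1 = B $ 2 $ 1 \<and> A $ 2 $ 2 = B $ 2 $ 2"
  for A B :: "complex^2^2"
  by (auto simp: vec_eq_iff forall_2)

lemma sl2_iff: "A \<in> sl2 \<longleftrightarrow> A $ 2 $ 2 = - (A $ 1 $ 1)"
  by (auto simp: sl2_def trace_def sum_2 eq_neg_iff_add_eq_0 add.commute)

lemma sl2_br_nth: "sl2_br A B $ i $ j =
    A $ i $ 1 * B $ 1 $ j + A $ i $ 2 * B $ 2 $ j - B $ i $ 1 * A $ 1 $ j - B $ i $ 2 * A $ 2 $ j"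
  by (simp add: sl2_br_def matrix_matrix_mult_def sum_2)

lemma lie_algebra_sl2: "lie_algebra_on mat_scale sl2 sl2_br"
proof -
  interpret vector_space mat_scale by (rule vector_space_mat_scale)
  show ?thesis
    by unfold_locales
      (auto simp: subspace_def sl2_iff mat2_eq_iff sl2_br_nth mat_scale_def algebra_simps)
qed

lemma sl2_chevalley:
  "sl2_e \<in> sl2" "sl2_f \<in> sl2" "sl2_h \<in> sl2"
  "sl2_br sl2_e sl2_f = sl2_h"
  "sl2_br sl2_h sl2_e = mat_scale 2 sl2_e"
  "sl2_br sl2_h sl2_f = mat_scale (- 2) sl2_f"
  by (simp_all add: sl2_iff mat2_eq_iff sl2_br_nth mat_scale_def sl2_e_def sl2_f_def sl2_h_def)

lemma sl2_decomp:
  assumes "A \<in> sl2"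
  shows "A = mat_scale (A $ 1 $ 2) sl2_e + mat_scale (A $ 2 $ 1) sl2_f + mat_scale (A $ 1 $ 1) sl2_h"
  using assms by (simp add: sl2_iff mat2_eq_iff mat_scale_def sl2_e_def sl2_f_def sl2_h_def)

lemma sl2_to_witt_chevalley:
  "sl2_to_witt sl2_f = witt_L (- 1)"
  "sl2_to_witt sl2_h = pm_scale (- 2) (witt_L 0)"
  "sl2_to_witt sl2_e = - witt_L 1"
  by (simp_all add: sl2_to_witt_def sl2_e_def sl2_f_def sl2_h_def)

lemma sl2_to_witt_in_witt: "sl2_to_witt A \<in> witt"
proof -
  have "witt_L k \<in> witt" if "k \<le> 1" for k
    using that by (simp add: witt_L_def witt_def free_space_def)
  then show ?thesis
    unfolding sl2_to_witt_def using subspace_free_space[of "{..1::int}", folded witt_def]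
    by (intro pm.subspace_add pm.subspace_scale pm.subspace_neg) auto
qed

lemma sl2_to_witt_br:
  assumes "A \<in> sl2" "B \<in> sl2"
  shows "sl2_to_witt (sl2_br A B) = witt_br (sl2_to_witt A) (sl2_to_witt B)"
proof -
  have *: "- witt_L k = pm_scale (- 1) (witt_L k)" for k by simp
  show ?thesis
    unfolding sl2_to_witt_def *
    by (rule poly_mapping_eqI)
      (use assms in \<open>simp add: witt_br_linear witt_br_L sl2_br_nth sl2_iff lookup_add del: pm.scale_minus_left,
        simp add: witt_L_def lookup_single when_def algebra_simps\<close>)
qed

lemma cong_2Z_shift:
  assumes "\<xi> \<in> UNIV // cong_2Z" "\<mu> \<in> \<xi>"
  shows "\<mu> + 2 * of_int k \<in> \<xi>"
proof -
  obtain x where x: "\<xi> = cong_2Z `` {x}" using assms(1) by (rule quotientE)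
  then obtain l :: int where "x - \<mu> = 2 * of_int l"
    using assms(2) by (auto simp: cong_2Z_def)
  then have "x - (\<mu> + 2 * of_int k) = 2 * of_int (l - k)"
    by (simp add: algebra_simps)
  then show ?thesis unfolding x cong_2Z_def by blast
qed

lemma equiv_cong_2Z: "equiv UNIV cong_2Z"
proof (rule equivI)
  show "refl cong_2Z"
    by (auto simp: refl_on_def cong_2Z_def intro: exI[of _ 0])
  show "sym cong_2Z"
  proof (rule symI)
    fix x y assume "(x, y) \<in> cong_2Z"
    then obtain k :: int where "x - y = 2 * of_int k" by (auto simp: cong_2Z_def)
    then have "y - x = 2 * of_int (- k)" by (simp add: algebra_simps)
    then show "(y, x) \<in> cong_2Z" unfolding cong_2Z_def by blast
  qed
  show "trans cong_2Z"
  proof (rule transI)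
    fix x y z assume "(x, y) \<in> cong_2Z" "(y, z) \<in> cong_2Z"
    then obtain k l :: int where "x - y = 2 * of_int k" "y - z = 2 * of_int l"
      by (auto simp: cong_2Z_def)
    then have "x - z = 2 * of_int (k + l)" by (simp add: algebra_simps)
    then show "(x, z) \<in> cong_2Z" unfolding cong_2Z_def by blast
  qed
qed simp

lemmas dense_efh_def = dense_e_def dense_f_def dense_h_def

lemma dense_closed:
  assumes "\<xi> \<in> UNIV // cong_2Z" "v \<in> free_space \<xi>"
  shows "dense_e \<tau> v \<in> free_space \<xi>" "dense_f v \<in> free_space \<xi>" "dense_h v \<in> free_space \<xi>"
proof -
  have "dense_v (\<mu> + 2) \<in> free_space \<xi>" "dense_v (\<mu> - 2) \<in> free_space \<xi>"
    "dense_v \<mu> \<in> free_space \<xi>" if "\<mu> \<in> \<xi>" for \<mu>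
    using cong_2Z_shift[OF assms(1) that, of 1] cong_2Z_shift[OF assms(1) that, of "- 1"] that
    by (simp_all add: dense_v_def free_space_def)
  then show "dense_e \<tau> v \<in> free_space \<xi>" "dense_f v \<in> free_space \<xi>" "dense_h v \<in> free_space \<xi>"
    unfolding dense_efh_def using assms(2) subspace_free_space[of \<xi>]
    by (auto intro!: lin_ext_in_free_space[of v \<xi>] pm.subspace_scale)
qed

lemma dense_efh_v:
  "dense_e \<tau> (dense_v \<mu>) = pm_scale (1/4 * (\<tau> - (\<mu> + 1)\<^sup>2)) (dense_v (\<mu> + 2))"
  "dense_f (dense_v \<mu>) = dense_v (\<mu> - 2)"
  "dense_h (dense_v \<mu>) = pm_scale \<mu> (dense_v \<mu>)"
  unfolding dense_efh_def by (subst dense_v_def, simp)+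

lemma dense_linear:
  "dense_e \<tau> (v + w) = dense_e \<tau> v + dense_e \<tau> w"
  "dense_f (v + w) = dense_f v + dense_f w"
  "dense_h (v + w) = dense_h v + dense_h w"
  "dense_e \<tau> (pm_scale c v) = pm_scale c (dense_e \<tau> v)"
  "dense_f (pm_scale c v) = pm_scale c (dense_f v)"
  "dense_h (pm_scale c v) = pm_scale c (dense_h v)"
  by (simp_all add: dense_efh_def)

lemma dense_relations:
  "dense_e \<tau> (dense_f v) = dense_f (dense_e \<tau> v) + dense_h v"
  "dense_h (dense_e \<tau> v) = dense_e \<tau> (dense_h v) + pm_scale 2 (dense_e \<tau> v)"
  "dense_h (dense_f v) = dense_f (dense_h v) - pm_scale 2 (dense_f v)"
proof (induction v rule: pm_induct)
  case (basis \<mu>)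
  {
    case 1
    have "dense_e \<tau> (dense_f (dense_v \<mu>)) = dense_f (dense_e \<tau> (dense_v \<mu>)) + dense_h (dense_v \<mu>)"
      by (rule poly_mapping_eqI)
        (simp add: dense_efh_v dense_linear lookup_add,
          simp add: dense_v_def lookup_single when_def power2_eq_square field_simps)
    then show ?case by (simp add: dense_v_def)
  next
    case 2
    have "dense_h (dense_e \<tau> (dense_v \<mu>)) =
        dense_e \<tau> (dense_h (dense_v \<mu>)) + pm_scale 2 (dense_e \<tau> (dense_v \<mu>))"
      by (rule poly_mapping_eqI)
        (simp add: dense_efh_v dense_linear lookup_add,
          simp add: dense_v_def lookup_single when_def power2_eq_square field_simps)
    then show ?case by (simp add: dense_v_def)
  next
    case 3
    have "dense_h (dense_f (dense_v \<mu>)) =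
        dense_f (dense_h (dense_v \<mu>)) - pm_scale 2 (dense_f (dense_v \<mu>))"
      by (rule poly_mapping_eqI)
        (simp add: dense_efh_v dense_linear lookup_minus,
          simp add: dense_v_def lookup_single when_def power2_eq_square field_simps)
    then show ?case by (simp add: dense_v_def)
  }
next
  case (scale c p)
  {
    case 1 then show ?case using scale by (simp add: dense_linear pm.scale_right_distrib)
  next
    case 2 then show ?case using scale
      by (simp add: dense_linear pm.scale_right_distrib mult.commute)
  next
    case 3 then show ?case using scale
      by (simp add: dense_linear pm.scale_right_diff_distrib mult.commute)
  }
next
  case (add p q)
  {
    case 1 then show ?case using add by (simp add: dense_linear algebra_simps)
  next
    case 2 then show ?case using add by (simp add: dense_linear pm.scale_right_distrib)
  next
    case 3 then show ?case using add by (simp add: dense_linear pm.scale_right_distrib)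
  }
qed

lemma lie_module_dense:
  assumes "\<xi> \<in> UNIV // cong_2Z"
  shows "lie_module_on mat_scale sl2 sl2_br pm_scale (free_space \<xi>) (dense_act \<xi> \<tau>)"
proof -
  interpret lie_algebra_on mat_scale sl2 sl2_br by (rule lie_algebra_sl2)
  define D where "D A v = pm_scale (A $ 1 $ 2) (dense_e \<tau> v) + pm_scale (A $ 2 $ 1) (dense_f v)
     + pm_scale (A $ 1 $ 1) (dense_h v)" for A :: "complex^2^2" and v
  have act: "dense_act \<xi> \<tau> A v = D A v" if "A \<in> sl2" "v \<in> free_space \<xi>" for A v
    using that by (simp add: dense_act_def D_def)
  have DV: "D A v \<in> free_space \<xi>" if "v \<in> free_space \<xi>" for A v
    unfolding D_def using dense_closed[OF assms that] subspace_free_space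
    by (intro pm.subspace_add pm.subspace_scale) auto
  have Dbr: "D (sl2_br A B) v = D A (D B v) - D B (D A v)" if "A \<in> sl2" "B \<in> sl2" for A B v
    by (rule poly_mapping_eqI)
      (use that in \<open>simp add: D_def dense_linear dense_relations sl2_br_nth sl2_iff lookup_add
        lookup_minus, simp add: algebra_simps\<close>)
  note V_closed = pm.subspace_add[OF subspace_free_space] pm.subspace_scale[OF subspace_free_space]
  show ?thesis
  proof
    show "pm.subspace (free_space \<xi>)" by (rule subspace_free_space)
    show "dense_act \<xi> \<tau> \<in> sl2 \<rightarrow>\<^sub>E free_space \<xi> \<rightarrow>\<^sub>E free_space \<xi>"
      using DV unfolding dense_act_def D_def by auto
  next
    fix A B v assume AB: "A \<in> sl2" "B \<in> sl2" and v: "v \<in> free_space \<xi>"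
    have "A + B \<in> sl2" using AB by (simp add: sl2_iff)
    then show "dense_act \<xi> \<tau> (A + B) v = dense_act \<xi> \<tau> A v + dense_act \<xi> \<tau> B v"
      using AB v by (simp add: act D_def pm.scale_left_distrib)
    show "dense_act \<xi> \<tau> (sl2_br A B) v
        = dense_act \<xi> \<tau> A (dense_act \<xi> \<tau> B v) - dense_act \<xi> \<tau> B (dense_act \<xi> \<tau> A v)"
      using AB v by (simp add: act DV Dbr br_closed)
  next
    fix A v w assume A: "A \<in> sl2" and vw: "v \<in> free_space \<xi>" "w \<in> free_space \<xi>"
    show "dense_act \<xi> \<tau> A (v + w) = dense_act \<xi> \<tau> A v + dense_act \<xi> \<tau> A w"
      using A vw by (simp add: act V_closed D_def dense_linear pm.scale_right_distrib)
  next
    fix A v c assume A: "A \<in> sl2" and v: "v \<in> free_space \<xi>"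
    have "mat_scale c A \<in> sl2" using A by (simp add: sl2_iff mat_scale_def)
    then show "dense_act \<xi> \<tau> (mat_scale c A) v = pm_scale c (dense_act \<xi> \<tau> A v)"
      using A v by (simp add: act D_def mat_scale_def pm.scale_right_distrib)
    show "dense_act \<xi> \<tau> A (pm_scale c v) = pm_scale c (dense_act \<xi> \<tau> A v)"
      using A v by (simp add: act V_closed D_def dense_linear pm.scale_right_distrib mult.commute)
  qed
qed

end

theory Submission
  imports Defs
begin

text \<open>
  Since \<open>[L\<^sub>0, L\<^sub>i] = - i L\<^sub>i\<close>, a compatible structure sends \<open>v\<^sub>\<mu>\<close> to a multiple
  \<open>C\<^sub>i(\<mu>)\<close> of \<open>v\<close> at \<open>\<mu> + 2i\<close>. The values \<open>C\<^sub>-\<^sub>1\<close>, \<open>C\<^sub>0\<close>, \<open>C\<^sub>1\<close> are those of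
  \<open>sl(2)\<close>, and bracketing with \<open>L\<^sub>-\<^sub>1\<close> expresses \<open>C\<^sub>i\<close> for \<open>i \<le> -3\<close> by \<open>C\<^sub>-\<^sub>2\<close>. So the structure is
  the single function \<open>a = C\<^sub>-\<^sub>2\<close> (\<open>compatible_structure_eqI\<close>), and two relations decide which \<open>a\<close>
  occur.

  Write \<open>c(\<mu>) = ((\<mu> + 1)\<^sup>2 - \<tau>)/4\<close> for \<open>C\<^sub>1\<close>. The relation \<open>[L\<^sub>1, L\<^sub>-\<^sub>2] = 3 L\<^sub>-\<^sub>1\<close> is a first order recurrence
  for \<open>a\<close>; multiplied by the summing factor \<open>c(\<mu> - 2)\<close> it says that
  \<open>a(\<mu>) c(\<mu> - 2) c(\<mu> - 4)\<close> is an explicit cubic in \<open>\<mu>\<close> plus a constant. That constant, suitably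
  normalised, is the invariant \<open>\<kappa>\<close> of the structure (\<open>kappa_constant\<close>). The relation
  \<open>[L\<^sub>-\<^sub>2, L\<^sub>-\<^sub>3] = L\<^sub>-\<^sub>5\<close> is quadratic in \<open>a\<close>; all dependence on \<open>\<mu>\<close> cancels and it becomes
  \<open>\<kappa>\<^sup>2 = 4 \<tau> (\<tau> - 1)\<^sup>2\<close> (\<open>kappa_squared\<close>), that is, \<open>\<kappa> = \<plusminus>2 s (s\<^sup>2 - 1)\<close> with \<open>s\<^sup>2 = \<tau>\<close>. The two
  signs coincide exactly for \<open>\<tau> = 0\<close> and \<open>\<tau> = 1\<close>.

  If the module is simple, \<open>c\<close> has no zero on \<open>\<xi>\<close>, so \<open>\<kappa>\<close> determines \<open>a\<close>; together with existence
  this gives the count. If both \<open>1 + s\<close> and \<open>1 - s\<close> lie in \<open>\<xi>\<close>, then \<open>c\<close> vanishes at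
  \<open>(1 \<plusminus> s) - 2\<close>, so \<open>\<kappa>\<close> can be read off at each of \<open>1 + s\<close> and \<open>1 - s\<close> and the two answers are
  opposite. This forces \<open>s (s\<^sup>2 - 1) = 0\<close>, and in these few cases one instance of the quadratic relation
  is contradictory (\<open>no_compatible_structure\<close>).

  For existence, let \<open>z = (1 + \<mu> + s)/2\<close>, which is never an integer if \<open>1 - s \<notin> \<xi>\<close>. Then
  \<open>P(z, i) = \<Gamma>(z + i)/\<Gamma>(z)\<close> is a multiplicative cocycle, so it drops out of the bracket relations, which
  reduce to a polynomial identity (\<open>density_coeff_bracket\<close>). The structure with \<open>-s\<close> in place of \<open>s\<close> has
  the opposite \<open>\<kappa>\<close>.
\<close>

section \<open>Cosets, basis vectors and induction\<close>

lemma cong_2Z_differ: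
  assumes "\<xi> \<in> UNIV // cong_2Z" "\<mu> \<in> \<xi>" "\<nu> \<in> \<xi>"
  obtains k :: int where "\<nu> = \<mu> + 2 * of_int k"
proof -
  have "(\<nu>, \<mu>) \<in> cong_2Z"
    using assms equiv_cong_2Z by (meson quotient_eq_iff)
  then obtain k :: int where "\<nu> - \<mu> = 2 * of_int k" by (auto simp: cong_2Z_def)
  then have "\<nu> = \<mu> + 2 * of_int k" by (simp add: algebra_simps)
  then show ?thesis by (rule that)
qed

lemma cong_2Z_nonempty: "\<xi> \<in> UNIV // cong_2Z \<Longrightarrow> \<exists>\<mu>. \<mu> \<in> \<xi>"
  using in_quotient_imp_non_empty[OF equiv_cong_2Z] by blast

lemma cong_2Z_shift_numeral:
  assumes "\<xi> \<in> UNIV // cong_2Z" "\<mu> \<in> \<xi>"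
  shows "\<mu> + 2 \<in> \<xi>" "\<mu> - 2 \<in> \<xi>" "\<mu> - 4 \<in> \<xi>" "\<mu> - 6 \<in> \<xi>"
  using cong_2Z_shift[OF assms, of 1] cong_2Z_shift[OF assms, of "- 1"]
    cong_2Z_shift[OF assms, of "- 2"] cong_2Z_shift[OF assms, of "- 3"]
  by simp_all

lemma dense_v_in_free_space [simp]: "dense_v \<mu> \<in> free_space \<xi> \<longleftrightarrow> \<mu> \<in> \<xi>"
  by (simp add: dense_v_def free_space_def)

lemma witt_L_in_witt [simp]: "witt_L k \<in> witt \<longleftrightarrow> k \<le> 1"
  by (simp add: witt_L_def witt_def free_space_def)

text \<open>Unlike \<open>pm_induct\<close>, this rule hands over membership of the basis index in \<open>I\<close>. That is
  needed because module axioms are available only on the carriers.\<close>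

lemma free_space_induct [consumes 1, case_names zero basis scale add]:
  assumes "p \<in> free_space I"
    and "P 0"
    and "\<And>i. i \<in> I \<Longrightarrow> P (Poly_Mapping.single i 1)"
    and "\<And>c p. p \<in> free_space I \<Longrightarrow> P p \<Longrightarrow> P (pm_scale c p)"
    and "\<And>p q. p \<in> free_space I \<Longrightarrow> q \<in> free_space I \<Longrightarrow> P p \<Longrightarrow> P q \<Longrightarrow> P (p + q)"
  shows "P p"
proof -
  note closed = pm.subspace_add[OF subspace_free_space] pm.subspace_scale[OF subspace_free_space]
    pm.subspace_0[OF subspace_free_space]
  have single: "Poly_Mapping.single i 1 \<in> free_space I" if "i \<in> I" for i
    using that by (simp add: free_space_def)
  have "(\<Sum>i\<in>S. pm_scale (Poly_Mapping.lookup p i) (Poly_Mapping.single i 1)) \<in> free_space I \<and>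
      P (\<Sum>i\<in>S. pm_scale (Poly_Mapping.lookup p i) (Poly_Mapping.single i 1))"
    if "finite S" "S \<subseteq> I" for S
    using that
    by (induction S rule: finite_induct) (auto intro!: assms closed single)
  moreover have "(\<Sum>i\<in>Poly_Mapping.keys p.
      pm_scale (Poly_Mapping.lookup p i) (Poly_Mapping.single i 1)) = p"
    by (rule poly_mapping_eqI)
      (auto simp: lookup_sum lookup_single when_def in_keys_iff if_distrib sum.delta cong: if_cong)
  moreover have "Poly_Mapping.keys p \<subseteq> I" using assms(1) by (simp add: free_space_def)
  ultimately show ?thesis by (metis finite_keys)
qed

lemma lookup_dense_h: "Poly_Mapping.lookup (dense_h w) \<nu> = \<nu> * Poly_Mapping.lookup w \<nu>"
proof (induction w rule: pm_induct)
  case (basis \<mu>)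
  show ?case using dense_efh_v(3)[of \<mu>]
    by (simp add: dense_v_def lookup_single when_def)
qed (simp_all add: dense_linear lookup_add algebra_simps)


section \<open>Compatible structures as families of scalars\<close>

text \<open>The value is the whole action of \<open>L\<^sub>i\<close> on \<open>v\<^sub>\<mu>\<close> only because \<open>L\<^sub>i v\<^sub>\<mu>\<close> has the weight
  \<open>\<mu> + 2i\<close>; see \<open>act_L_v\<close> below.\<close>

definition witt_coeff ::
    "((int \<Rightarrow>\<^sub>0 complex) \<Rightarrow> (complex \<Rightarrow>\<^sub>0 complex) \<Rightarrow> (complex \<Rightarrow>\<^sub>0 complex)) \<Rightarrow> int \<Rightarrow> complex \<Rightarrow> complex"
  where "witt_coeff \<rho> i \<mu> = Poly_Mapping.lookup (\<rho> (witt_L i) (dense_v \<mu>)) (\<mu> + 2 * of_int i)"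

text \<open>The coefficient of \<open>L\<^sub>1 = -e\<close>; it vanishes at \<open>\<mu>\<close> iff \<open>\<mu> + 2\<close> is one of the roots
  \<open>1 \<plusminus> s\<close> of \<open>(x - 1)\<^sup>2 - \<tau>\<close>.\<close>

definition raising_coeff :: "complex \<Rightarrow> complex \<Rightarrow> complex" where
  "raising_coeff \<tau> \<mu> = ((\<mu> + 1)\<^sup>2 - \<tau>) / 4"

locale compatible_structure =
  fixes \<xi> :: "complex set" and \<tau> :: complex
    and \<rho> :: "(int \<Rightarrow>\<^sub>0 complex) \<Rightarrow> (complex \<Rightarrow>\<^sub>0 complex) \<Rightarrow> (complex \<Rightarrow>\<^sub>0 complex)"
  assumes coset: "\<xi> \<in> UNIV // cong_2Z"
    and compatible: "\<rho> \<in> compatible_witt_structures \<xi> \<tau>"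
begin

lemma witt_module: "lie_module_on pm_scale witt witt_br pm_scale (free_space \<xi>) \<rho>"
  using compatible by (simp add: compatible_witt_structures_def)

sublocale lie_module_on pm_scale witt witt_br pm_scale "free_space \<xi>" \<rho>
  by (rule witt_module)

abbreviation C where "C \<equiv> witt_coeff \<rho>"

lemma act_closed: "x \<in> witt \<Longrightarrow> v \<in> free_space \<xi> \<Longrightarrow> \<rho> x v \<in> free_space \<xi>"
  using act_funcset by (auto simp: PiE_def Pi_def)

lemma restricts_to_sl2:
  "A \<in> sl2 \<Longrightarrow> v \<in> free_space \<xi> \<Longrightarrow> \<rho> (sl2_to_witt A) v = dense_act \<xi> \<tau> A v"
  using compatible by (simp add: compatible_witt_structures_def)

lemma act_L_minus_1:
  assumes "v \<in> free_space \<xi>"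
  shows "\<rho> (witt_L (- 1)) v = dense_f v"
  using restricts_to_sl2[OF sl2_chevalley(2) assms] assms
  by (simp add: sl2_to_witt_chevalley dense_act_def sl2_chevalley) (simp add: sl2_f_def)

lemma act_L_0:
  assumes "v \<in> free_space \<xi>"
  shows "\<rho> (witt_L 0) v = pm_scale (- 1 / 2) (dense_h v)"
proof -
  have "pm_scale (- 2) (\<rho> (witt_L 0) v) = dense_h v"
    using restricts_to_sl2[OF sl2_chevalley(3) assms] assms act_scale_left[of "witt_L 0" v "- 2"]
    by (simp add: sl2_to_witt_chevalley dense_act_def sl2_chevalley) (simp add: sl2_h_def)
  then have "pm_scale (- 1 / 2) (pm_scale (- 2) (\<rho> (witt_L 0) v)) = pm_scale (- 1 / 2) (dense_h v)"
    by (rule arg_cong)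
  then show ?thesis by simp
qed

lemma act_L_1:
  assumes "v \<in> free_space \<xi>"
  shows "\<rho> (witt_L 1) v = - dense_e \<tau> v"
proof -
  have "- \<rho> (witt_L 1) v = dense_e \<tau> v"
    using restricts_to_sl2[OF sl2_chevalley(1) assms] assms act_scale_left[of "witt_L 1" v "- 1"]
    by (simp add: sl2_to_witt_chevalley dense_act_def sl2_chevalley) (simp add: sl2_e_def)
  then show ?thesis by (metis minus_minus)
qed

text \<open>\<open>L\<^sub>0\<close> is \<open>-h/2\<close>, so \<open>[L\<^sub>0, L\<^sub>i] = - i L\<^sub>i\<close> makes \<open>L\<^sub>i v\<^sub>\<mu>\<close> an eigenvector of \<open>h\<close> with
  eigenvalue \<open>\<mu> + 2i\<close>, and the eigenspaces of \<open>h\<close> are lines.\<close>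

lemma act_L_v:
  assumes "i \<le> 1" "\<mu> \<in> \<xi>"
  shows "\<rho> (witt_L i) (dense_v \<mu>) = pm_scale (C i \<mu>) (dense_v (\<mu> + 2 * of_int i))"
proof -
  define w where "w = \<rho> (witt_L i) (dense_v \<mu>)"
  have w: "w \<in> free_space \<xi>" unfolding w_def using assms by (intro act_closed) auto
  have "\<rho> (witt_br (witt_L 0) (witt_L i)) (dense_v \<mu>) =
      \<rho> (witt_L 0) w - \<rho> (witt_L i) (\<rho> (witt_L 0) (dense_v \<mu>))"
    unfolding w_def using assms by (intro act_br) auto
  then have eq: "pm_scale (of_int (- i)) w = pm_scale (- 1 / 2) (dense_h w) - pm_scale (- \<mu> / 2) w"
    using assms w
      act_scale_left[of "witt_L i" "dense_v \<mu>" "of_int (- i)"]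
      act_scale_right[of "witt_L i" "dense_v \<mu>" "- \<mu> / 2"]
    by (simp add: witt_br_L act_L_0 dense_efh_v flip: w_def)
  have "Poly_Mapping.lookup w \<nu> = 0" if "\<nu> \<noteq> \<mu> + 2 * of_int i" for \<nu>
  proof -
    have "of_int (- i) * Poly_Mapping.lookup w \<nu> =
        - 1 / 2 * (\<nu> * Poly_Mapping.lookup w \<nu>) + \<mu> / 2 * Poly_Mapping.lookup w \<nu>"
      using arg_cong[OF eq, of "\<lambda>p. Poly_Mapping.lookup p \<nu>"]
      by (simp add: lookup_minus lookup_dense_h)
    then have "(\<nu> - (\<mu> + 2 * of_int i)) * Poly_Mapping.lookup w \<nu> = 0"
      by (simp add: field_simps)
    then show ?thesis using that by simp
  qed
  then show ?thesis
    by (intro poly_mapping_eqI)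
      (auto simp: witt_coeff_def dense_v_def[of "\<mu> + _"] lookup_single when_def simp flip: w_def)
qed

lemma C_sl2:
  assumes "\<mu> \<in> \<xi>"
  shows "C (- 1) \<mu> = 1" "C 0 \<mu> = - \<mu> / 2" "C 1 \<mu> = raising_coeff \<tau> \<mu>"
  using assms
  by (simp_all add: witt_coeff_def act_L_minus_1 act_L_0 act_L_1 dense_efh_v)
    (simp_all add: dense_v_def raising_coeff_def field_simps)

lemma C_bracket:
  assumes "i \<le> 1" "j \<le> 1" "i + j \<le> 1" "\<mu> \<in> \<xi>"
  shows "of_int (i - j) * C (i + j) \<mu> =
    C j \<mu> * C i (\<mu> + 2 * of_int j) - C i \<mu> * C j (\<mu> + 2 * of_int i)"
proof -
  have shift: "\<mu> + 2 * of_int j \<in> \<xi>" "\<mu> + 2 * of_int i \<in> \<xi>"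
    using cong_2Z_shift[OF coset assms(4)] by auto
  have "\<rho> (witt_br (witt_L i) (witt_L j)) (dense_v \<mu>) =
      \<rho> (witt_L i) (\<rho> (witt_L j) (dense_v \<mu>)) - \<rho> (witt_L j) (\<rho> (witt_L i) (dense_v \<mu>))"
    using assms by (intro act_br) auto
  then have "pm_scale (of_int (i - j)) (pm_scale (C (i + j) \<mu>) (dense_v (\<mu> + 2 * of_int (i + j)))) =
      pm_scale (C j \<mu>) (pm_scale (C i (\<mu> + 2 * of_int j)) (dense_v (\<mu> + 2 * of_int j + 2 * of_int i)))
      - pm_scale (C i \<mu>) (pm_scale (C j (\<mu> + 2 * of_int i)) (dense_v (\<mu> + 2 * of_int i + 2 * of_int j)))"
    using assms shift by (simp only: witt_br_L act_scale_left act_scale_right act_L_v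
        witt_L_in_witt dense_v_in_free_space)
  then show ?thesis
    by (auto dest!: arg_cong[where f = "\<lambda>p. Poly_Mapping.lookup p (\<mu> + 2 * of_int (i + j))"]
        simp: lookup_minus lookup_add dense_v_def lookup_single when_def algebra_simps)
qed

lemma L_1_L_minus_2:
  assumes "\<mu> \<in> \<xi>"
  shows "C (- 2) \<mu> * raising_coeff \<tau> (\<mu> - 4) - raising_coeff \<tau> \<mu> * C (- 2) (\<mu> + 2) = 3"
  using C_bracket[of 1 "- 2" \<mu>] assms cong_2Z_shift_numeral[OF coset assms] by (simp add: C_sl2)

text \<open>Bracketing with \<open>L\<^sub>-\<^sub>1\<close>, which acts with all coefficients 1, takes differences. The factor on the left is nonzero
  for \<open>i \<le> -2\<close>, hence everything below \<open>L\<^sub>-\<^sub>2\<close> is determined by \<open>L\<^sub>-\<^sub>2\<close>.\<close>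

lemma C_descend:
  assumes "i \<le> - 2" "\<mu> \<in> \<xi>"
  shows "of_int (- 1 - i) * C (i - 1) \<mu> = C i \<mu> - C i (\<mu> - 2)"
  using C_bracket[of "- 1" i \<mu>] assms cong_2Z_shift[OF coset assms(2), of i]
  by (simp add: C_sl2 algebra_simps)

text \<open>This is \<open>[L\<^sub>-\<^sub>2, L\<^sub>-\<^sub>3] = L\<^sub>-\<^sub>5\<close> with \<open>C\<^sub>-\<^sub>3\<close>, \<open>C\<^sub>-\<^sub>4\<close>, \<open>C\<^sub>-\<^sub>5\<close> written as first, second and third
  differences of \<open>C\<^sub>-\<^sub>2\<close>.\<close>

lemma L_minus_2_L_minus_3:
  assumes "\<mu> \<in> \<xi>"
  shows "6 * (2 * C (- 2) \<mu> * C (- 2) (\<mu> - 6) - C (- 2) (\<mu> - 2) * C (- 2) (\<mu> - 6)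
      - C (- 2) \<mu> * C (- 2) (\<mu> - 4))
    = C (- 2) \<mu> - 3 * C (- 2) (\<mu> - 2) + 3 * C (- 2) (\<mu> - 4) - C (- 2) (\<mu> - 6)"
proof -
  have C3: "C (- 3) \<nu> = C (- 2) \<nu> - C (- 2) (\<nu> - 2)" if "\<nu> \<in> \<xi>" for \<nu>
    using C_descend[of "- 2" \<nu>] that by simp
  have C4: "2 * C (- 4) \<nu> = C (- 3) \<nu> - C (- 3) (\<nu> - 2)" if "\<nu> \<in> \<xi>" for \<nu>
    using C_descend[of "- 3" \<nu>] that by simp
  have C5: "3 * C (- 5) \<mu> = C (- 4) \<mu> - C (- 4) (\<mu> - 2)"
    using C_descend[of "- 4" \<mu>] assms by simp
  have C5': "C (- 5) \<mu> = C (- 3) \<mu> * C (- 2) (\<mu> - 6) - C (- 2) \<mu> * C (- 3) (\<mu> - 4)"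
    using C_bracket[of "- 2" "- 3" \<mu>] assms by simp
  note shifts = assms cong_2Z_shift_numeral[OF coset assms]
  have "6 * C (- 5) \<mu> = C (- 3) \<mu> - 2 * C (- 3) (\<mu> - 2) + C (- 3) (\<mu> - 4)"
    using C5 C4[OF shifts(1)] C4[OF shifts(3)] by simp algebra
  then show ?thesis
    unfolding C5' using C3[OF shifts(1)] C3[OF shifts(3)] C3[OF shifts(4)]
    by (simp add: algebra_simps)
qed

end

lemma compatible_structure_eqI:
  assumes \<rho>: "compatible_structure \<xi> \<tau> \<rho>" and \<rho>': "compatible_structure \<xi> \<tau> \<rho>'"
    and L_minus_2: "\<And>\<mu>. \<mu> \<in> \<xi> \<Longrightarrow> witt_coeff \<rho> (- 2) \<mu> = witt_coeff \<rho>' (- 2) \<mu>"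
  shows "\<rho> = \<rho>'"
proof -
  interpret A: compatible_structure \<xi> \<tau> \<rho> by (rule \<rho>)
  interpret B: compatible_structure \<xi> \<tau> \<rho>' by (rule \<rho>')
  have low: "\<forall>\<mu>\<in>\<xi>. A.C i \<mu> = B.C i \<mu>" if "i \<le> - 2" for i
    using that
  proof (induction i rule: int_le_induct)
    case base then show ?case using L_minus_2 by simp
  next
    case (step i)
    show ?case
    proof
      fix \<mu> assume \<mu>: "\<mu> \<in> \<xi>"
      have "of_int (- 1 - i) * A.C (i - 1) \<mu> = of_int (- 1 - i) * B.C (i - 1) \<mu>"
        using A.C_descend[OF step(1) \<mu>] B.C_descend[OF step(1) \<mu>] step.IH \<mu>
          cong_2Z_shift_numeral[OF A.coset \<mu>] by simp
      moreover have "of_int (- 1 - i) \<noteq> (0::complex)" using step(1) by (simp only: of_int_eq_0_iff)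
      ultimately show "A.C (i - 1) \<mu> = B.C (i - 1) \<mu>" by (meson mult_left_cancel)
    qed
  qed
  have all: "A.C i \<mu> = B.C i \<mu>" if "i \<le> 1" "\<mu> \<in> \<xi>" for i \<mu>
  proof -
    have "i \<le> - 2 \<or> i = - 1 \<or> i = 0 \<or> i = 1" using that(1) by arith
    then consider "i \<le> - 2" | "i = - 1" | "i = 0" | "i = 1" by blast
    then show ?thesis using low that(2) by cases (auto simp: A.C_sl2 B.C_sl2)
  qed
  have L: "\<rho> (witt_L i) v = \<rho>' (witt_L i) v" if "i \<le> 1" "v \<in> free_space \<xi>" for i v
    using that(2)
  proof (induction v rule: free_space_induct)
    case zero
    show ?case using A.act_scale_right[of "witt_L i" 0 0] B.act_scale_right[of "witt_L i" 0 0] that(1)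
      by (simp add: pm.subspace_0[OF subspace_free_space])
  next
    case (basis \<mu>)
    show ?case using A.act_L_v[of i \<mu>] B.act_L_v[of i \<mu>] all that(1) basis by (simp add: dense_v_def)
  qed (use that(1) in \<open>simp_all add: A.act_scale_right B.act_scale_right A.act_add_right B.act_add_right\<close>)
  have "\<rho> x v = \<rho>' x v" if "x \<in> witt" "v \<in> free_space \<xi>" for x v
    using that(1)[unfolded witt_def]
  proof (induction x rule: free_space_induct)
    case zero
    show ?case using A.act_scale_left[of 0 v 0] B.act_scale_left[of 0 v 0] that(2)
      by (simp add: pm.subspace_0[OF subspace_free_space] witt_def)
  next
    case (basis i)
    then show ?case using L[of i v] that(2) by (simp add: witt_L_def)
  qed (use that(2) in \<open>simp_all add: A.act_scale_left B.act_scale_left A.act_add_left B.act_add_left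
      flip: witt_def\<close>)
  then have "\<rho> x = \<rho>' x" if "x \<in> witt" for x
    using PiE_ext[OF PiE_mem[OF A.act_funcset that] PiE_mem[OF B.act_funcset that]] that by blast
  then show ?thesis
    using PiE_ext[OF A.act_funcset B.act_funcset] by blast
qed


section \<open>The invariant of a compatible structure\<close>

text \<open>Up to sign, the cubic is the particular solution of the recurrence for \<open>8 C\<^sub>-\<^sub>2(\<mu>) c(\<mu> - 2) c(\<mu> - 4)\<close> that
  is odd about \<open>\<mu> = 2\<close>. With this choice the two admissible values of the constant are opposite to
  each other, and the factor 8 clears denominators.\<close>

definition kappa ::
    "complex \<Rightarrow> ((int \<Rightarrow>\<^sub>0 complex) \<Rightarrow> (complex \<Rightarrow>\<^sub>0 complex) \<Rightarrow> (complex \<Rightarrow>\<^sub>0 complex)) \<Rightarrow> complex \<Rightarrow> complex"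
  where "kappa \<tau> \<rho> \<mu> =
    8 * (witt_coeff \<rho> (- 2) \<mu> * raising_coeff \<tau> (\<mu> - 2) * raising_coeff \<tau> (\<mu> - 4))
    + (\<mu> - 2) * ((\<mu> - 2)\<^sup>2 - 3 * \<tau> - 1)"

context compatible_structure
begin

text \<open>The recurrence given by \<open>[L\<^sub>1, L\<^sub>-\<^sub>2] = 3 L\<^sub>-\<^sub>1\<close>, multiplied by \<open>c(\<mu> - 2)\<close>, telescopes: its two
  terms become the values of one function at \<open>\<mu>\<close> and \<open>\<mu> + 2\<close>.\<close>

lemma kappa_shift:
  assumes "\<mu> \<in> \<xi>"
  shows "kappa \<tau> \<rho> (\<mu> + 2) = kappa \<tau> \<rho> \<mu>"
proof -
  define a b where "a = C (- 2) \<mu>" and "b = C (- 2) (\<mu> + 2)"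
  have "a * raising_coeff \<tau> (\<mu> - 4) - raising_coeff \<tau> \<mu> * b = 3"
    unfolding a_def b_def by (rule L_1_L_minus_2[OF assms])
  then have "(a * raising_coeff \<tau> (\<mu> - 4) - raising_coeff \<tau> \<mu> * b) * raising_coeff \<tau> (\<mu> - 2)
      = 3 * raising_coeff \<tau> (\<mu> - 2)"
    by (rule arg_cong)
  then have "b * raising_coeff \<tau> \<mu> * raising_coeff \<tau> (\<mu> - 2)
      = a * raising_coeff \<tau> (\<mu> - 2) * raising_coeff \<tau> (\<mu> - 4) - 3 * raising_coeff \<tau> (\<mu> - 2)"
    by (simp add: algebra_simps)
  moreover have "\<mu> * (\<mu>\<^sup>2 - 3 * \<tau> - 1)
      = (\<mu> - 2) * ((\<mu> - 2)\<^sup>2 - 3 * \<tau> - 1) + 24 * raising_coeff \<tau> (\<mu> - 2)"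
    by (simp add: raising_coeff_def field_simps power2_eq_square)
  moreover have "kappa \<tau> \<rho> (\<mu> + 2) = 8 * (b * raising_coeff \<tau> \<mu> * raising_coeff \<tau> (\<mu> - 2))
      + \<mu> * (\<mu>\<^sup>2 - 3 * \<tau> - 1)"
    by (simp add: kappa_def b_def)
  ultimately show ?thesis unfolding kappa_def[of \<tau> \<rho> \<mu>] a_def[symmetric] by simp
qed

lemma kappa_constant:
  assumes "\<mu> \<in> \<xi>" "\<nu> \<in> \<xi>"
  shows "kappa \<tau> \<rho> \<nu> = kappa \<tau> \<rho> \<mu>"
proof -
  obtain k :: int where k: "\<nu> = \<mu> + 2 * of_int k" using cong_2Z_differ[OF coset assms] .
  have "kappa \<tau> \<rho> (\<mu> + 2 * of_int k) = kappa \<tau> \<rho> \<mu>"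
  proof (induction k rule: int_induct[of _ 0])
    case base show ?case by simp
  next
    case (step1 i)
    then show ?case using kappa_shift[OF cong_2Z_shift[OF coset assms(1), of i]]
      by (simp add: algebra_simps)
  next
    case (step2 i)
    then show ?case using kappa_shift[OF cong_2Z_shift[OF coset assms(1), of "i - 1"]]
      by (simp add: algebra_simps)
  qed
  then show ?thesis by (simp add: k)
qed

end

text \<open>The degree 5 relation after clearing denominators, centred at \<open>p = \<mu> - 5\<close>, where the five factors
  \<open>4 c\<close> involved are \<open>(p + 2j)\<^sup>2 - \<tau>\<close> for \<open>|j| \<le> 2\<close>. The coefficient of \<open>k\<^sup>2\<close> is the constant
  \<open>12 (2 c(p) - c(p + 4) - c(p - 4)) = -384\<close>, a second difference of a quadratic polynomial.\<close>

lemma degree_5_identity: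
  fixes p t k :: complex
  defines "B \<equiv> \<lambda>m. k - m * (m\<^sup>2 - 3 * t - 1)" and "c \<equiv> \<lambda>q. q\<^sup>2 - t"
  shows "12 * (2 * B (p + 3) * B (p - 3) * c p - B (p + 1) * B (p - 3) * c (p + 4)
        - B (p + 3) * B (p - 1) * c (p - 4))
      - (B (p + 3) * c p * c (p - 2) * c (p - 4) - 3 * B (p + 1) * c (p + 4) * c (p - 2) * c (p - 4)
      + 3 * B (p - 1) * c (p + 4) * c (p + 2) * c (p - 4) - B (p - 3) * c (p + 4) * c (p + 2) * c p)
      = - 384 * (k\<^sup>2 - 4 * t * (t - 1)\<^sup>2)"
  unfolding B_def c_def by algebra

text \<open>Multiplying the relation by the product of all five factors \<open>c\<close> gives every term the factors that
  turn its \<open>A\<^sub>j\<close> into values of the polynomial \<open>B\<close>, without any division.\<close>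

lemma degree_5_relation:
  fixes A0 A1 A2 A3 p t k :: complex
  defines "B \<equiv> \<lambda>m. k - m * (m\<^sup>2 - 3 * t - 1)" and "c \<equiv> \<lambda>q. q\<^sup>2 - t"
  assumes A: "A0 * c (p + 4) * c (p + 2) = 2 * B (p + 3)"
      "A1 * c (p + 2) * c p = 2 * B (p + 1)"
      "A2 * c p * c (p - 2) = 2 * B (p - 1)"
      "A3 * c (p - 2) * c (p - 4) = 2 * B (p - 3)"
    and rel: "6 * (2 * A0 * A3 - A1 * A3 - A0 * A2) = A0 - 3 * A1 + 3 * A2 - A3"
  shows "k\<^sup>2 = 4 * t * (t - 1)\<^sup>2"
proof -
  have "6 * (2 * (A0 * c (p + 4) * c (p + 2)) * (A3 * c (p - 2) * c (p - 4)) * c p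
        - (A1 * c (p + 2) * c p) * (A3 * c (p - 2) * c (p - 4)) * c (p + 4)
        - (A0 * c (p + 4) * c (p + 2)) * (A2 * c p * c (p - 2)) * c (p - 4))
      = (6 * (2 * A0 * A3 - A1 * A3 - A0 * A2)) * (c (p + 4) * c (p + 2) * c p * c (p - 2) * c (p - 4))"
    by algebra
  also have "\<dots> = (A0 * c (p + 4) * c (p + 2)) * c p * c (p - 2) * c (p - 4)
      - 3 * (A1 * c (p + 2) * c p) * c (p + 4) * c (p - 2) * c (p - 4)
      + 3 * (A2 * c p * c (p - 2)) * c (p + 4) * c (p + 2) * c (p - 4)
      - (A3 * c (p - 2) * c (p - 4)) * c (p + 4) * c (p + 2) * c p"
    unfolding rel by algebra
  finally have "12 * (2 * B (p + 3) * B (p - 3) * c p - B (p + 1) * B (p - 3) * c (p + 4)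
        - B (p + 3) * B (p - 1) * c (p - 4))
      = B (p + 3) * c p * c (p - 2) * c (p - 4) - 3 * B (p + 1) * c (p + 4) * c (p - 2) * c (p - 4)
      + 3 * B (p - 1) * c (p + 4) * c (p + 2) * c (p - 4) - B (p - 3) * c (p + 4) * c (p + 2) * c p"
    unfolding A by algebra
  then have "- 384 * (k\<^sup>2 - 4 * t * (t - 1)\<^sup>2) = 0"
    unfolding B_def c_def
    by (rule trans[OF sym[OF degree_5_identity[where k = k and p = p and t = t]] iffD2[OF right_minus_eq]])
  then show ?thesis by (simp add: mult.assoc)
qed

lemma (in compatible_structure) kappa_squared:
  assumes "\<mu> \<in> \<xi>"
  shows "(kappa \<tau> \<rho> \<mu>)\<^sup>2 = 4 * \<tau> * (\<tau> - 1)\<^sup>2"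
proof -
  note shifts = cong_2Z_shift_numeral[OF coset assms]
  have B: "C (- 2) \<nu> * ((\<nu> - 1)\<^sup>2 - \<tau>) * ((\<nu> - 3)\<^sup>2 - \<tau>)
      = 2 * (kappa \<tau> \<rho> \<mu> - (\<nu> - 2) * ((\<nu> - 2)\<^sup>2 - 3 * \<tau> - 1))" if "\<nu> \<in> \<xi>" for \<nu>
    unfolding kappa_constant[OF that assms] by (simp add: kappa_def raising_coeff_def)
  show ?thesis
    using degree_5_relation[where p = "\<mu> - 5" and k = "kappa \<tau> \<rho> \<mu>" and t = \<tau>,
        OF _ _ _ _ L_minus_2_L_minus_3[OF assms]]
      B[OF assms] B[OF shifts(2)] B[OF shifts(3)] B[OF shifts(4)]
    by simp
qed

lemma compatible_structure_eqI_kappa: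
  assumes \<rho>: "compatible_structure \<xi> \<tau> \<rho>" and \<rho>': "compatible_structure \<xi> \<tau> \<rho>'"
    and nonzero: "\<And>\<mu>. \<mu> \<in> \<xi> \<Longrightarrow> raising_coeff \<tau> \<mu> \<noteq> 0"
    and "\<mu>\<^sub>0 \<in> \<xi>" "kappa \<tau> \<rho> \<mu>\<^sub>0 = kappa \<tau> \<rho>' \<mu>\<^sub>0"
  shows "\<rho> = \<rho>'"
proof (rule compatible_structure_eqI[OF \<rho> \<rho>'])
  fix \<mu> assume \<mu>: "\<mu> \<in> \<xi>"
  interpret A: compatible_structure \<xi> \<tau> \<rho> by (rule \<rho>)
  interpret B: compatible_structure \<xi> \<tau> \<rho>' by (rule \<rho>')
  have "kappa \<tau> \<rho> \<mu> = kappa \<tau> \<rho>' \<mu>"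
    using A.kappa_constant[OF assms(4) \<mu>] B.kappa_constant[OF assms(4) \<mu>] assms(5) by simp
  then show "A.C (- 2) \<mu> = B.C (- 2) \<mu>"
    using nonzero cong_2Z_shift_numeral[OF A.coset \<mu>] by (simp add: kappa_def)
qed


section \<open>The obstruction\<close>

lemma raising_coeff_factor: "raising_coeff (s\<^sup>2) \<mu> = (\<mu> + 1 - s) * (\<mu> + 1 + s) / 4"
  by (simp add: raising_coeff_def power2_eq_square field_simps)

text \<open>At \<open>\<mu> = 1 \<plusminus> s\<close> the factor \<open>c(\<mu> - 2)\<close> of \<open>\<kappa>(\<mu>)\<close> is zero, so there \<open>\<kappa>\<close> equals its cubic
  part, whatever the structure is. The values at \<open>1 + s\<close> and \<open>1 - s\<close> are opposite and must agree.\<close>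

lemma no_compatible_structure:
  assumes "compatible_structure \<xi> (s\<^sup>2) \<rho>" and roots: "1 + s \<in> \<xi>" "1 - s \<in> \<xi>"
  shows False
proof -
  interpret compatible_structure \<xi> "s\<^sup>2" \<rho> by fact
  have zero: "raising_coeff (s\<^sup>2) (1 + s - 2) = 0" "raising_coeff (s\<^sup>2) (1 - s - 2) = 0"
    by (simp_all add: raising_coeff_factor)
  have "kappa (s\<^sup>2) \<rho> (1 + s) = - 2 * s * (s\<^sup>2 - 1)"
    unfolding kappa_def zero by algebra
  moreover have "kappa (s\<^sup>2) \<rho> (1 - s) = 2 * s * (s\<^sup>2 - 1)"
    unfolding kappa_def zero by algebra
  ultimately have "- 2 * s * (s\<^sup>2 - 1) = 2 * s * (s\<^sup>2 - 1)"
    using kappa_constant[OF roots] by simp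
  then have "4 * (s * (s\<^sup>2 - 1)) = 0" by algebra
  then have "s * (s\<^sup>2 - 1) = 0" by simp
  then consider "s = 0" | "s = 1" | "s = - 1" by (auto simp: power2_eq_1_iff)
  \<comment> \<open>The roots \<open>1 \<plusminus> s\<close> decide which coset \<open>\<xi>\<close> is: the odd integers or the even integers.\<close>
  then consider "s = 0" "1 \<in> \<xi>" | "s\<^sup>2 = 1" "0 \<in> \<xi>"
    using roots by cases auto
  moreover have solve: "y = (x - c) / d" if "x - d * y = c" "d \<noteq> 0" for x y c d :: complex
    using that by (auto simp: field_simps)
  ultimately show False
  proof cases
    case 1
    have mem: "1 + 2 * of_int k \<in> \<xi>" for k using cong_2Z_shift[OF coset \<open>1 \<in> \<xi>\<close>] .
    have mems: "3 \<in> \<xi>" "5 \<in> \<xi>" "7 \<in> \<xi>"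
      using mem[of 1] mem[of 2] mem[of 3] by simp_all
    \<comment> \<open>Only \<open>C\<^sub>-\<^sub>2(3)\<close> stays free, and it cancels from the degree 5 relation at \<open>\<mu> = 7\<close>.\<close>
    have "0 - 4 * C (- 2) 5 = 3"
      using L_1_L_minus_2[OF mems(1)] 1(1) by (simp add: raising_coeff_def)
    from solve[OF this] have C5: "C (- 2) 5 = - 3 / 4" by simp
    have "C (- 2) 5 - 9 * C (- 2) 7 = 3"
      using L_1_L_minus_2[OF mems(2)] 1(1) by (simp add: raising_coeff_def)
    from solve[OF this] have C7: "C (- 2) 7 = - 5 / 12" by (simp add: C5)
    have "C (- 2) 1 - C (- 2) 3 = 3"
      using L_1_L_minus_2[OF 1(2)] 1(1) by (simp add: raising_coeff_def)
    then have C1: "C (- 2) 1 = C (- 2) 3 + 3" by (simp add: diff_eq_eq add.commute)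
    show False
      using L_minus_2_L_minus_3[OF mems(3)] by (simp add: C5 C7 C1 field_simps)
  next
    case 2
    have mem: "0 + 2 * of_int k \<in> \<xi>" for k using cong_2Z_shift[OF coset \<open>0 \<in> \<xi>\<close>] .
    have mems: "2 \<in> \<xi>" "4 \<in> \<xi>" "- 2 \<in> \<xi>"
      using mem[of 1] mem[of 2] mem[of "- 1"] by simp_all
    \<comment> \<open>Only \<open>C\<^sub>-\<^sub>2(2)\<close> stays free, and it cancels from the degree 5 relation at \<open>\<mu> = 4\<close>.\<close>
    have "0 - 2 * C (- 2) 4 = 3"
      using L_1_L_minus_2[OF mems(1)] 2(1) by (simp add: raising_coeff_def)
    from solve[OF this] have C4: "C (- 2) 4 = - 3 / 2" by simp
    have C0: "C (- 2) 0 = 3 / 2"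
      using L_1_L_minus_2[OF 2(2)] 2(1) by (simp add: raising_coeff_def divide_simps mult.commute)
    have Cm2: "C (- 2) (- 2) = 1 / 2"
      using L_1_L_minus_2[OF mems(3)] 2(1) by (simp add: raising_coeff_def divide_simps mult.commute)
    show False
      using L_minus_2_L_minus_3[OF mems(2)] by (simp add: C4 C0 Cm2 field_simps)
  qed
qed


section \<open>Construction of the structures\<close>

lemma nonint_add_of_int:
  fixes z :: complex
  assumes "z \<notin> \<int>"
  shows "z + of_int n \<notin> \<int>"
  using assms Ints_diff[of "z + of_int n" "of_int n"] by auto

lemma int_pochhammer_Gamma:
  assumes "z \<notin> \<int>"
  shows "int_pochhammer z n = Gamma (z + of_int n) / Gamma z"
proof (cases "n \<ge> 0")
  case True
  have "z \<notin> \<int>\<^sub>\<le>\<^sub>0" using assms by (auto dest: nonpos_Ints_Int)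
  then show ?thesis using True by (simp add: int_pochhammer_def pochhammer_Gamma)
next
  case False
  have "z + of_int n \<notin> \<int>" using assms by (rule nonint_add_of_int)
  then have "z + of_int n \<notin> \<int>\<^sub>\<le>\<^sub>0" by (auto dest: nonpos_Ints_Int)
  then show ?thesis using False by (simp add: int_pochhammer_def pochhammer_Gamma)
qed

text \<open>Both sides are quotients of Gamma values, which telescope. If \<open>z\<close> were an integer this could fail,
  for instance for \<open>z = 0\<close>, \<open>m = 1\<close>, \<open>n = -1\<close>.\<close>

lemma int_pochhammer_add:
  assumes "z \<notin> \<int>"
  shows "int_pochhammer z (m + n) = int_pochhammer z m * int_pochhammer (z + of_int m) n"
proof -
  have zm: "z + of_int m \<notin> \<int>" using assms by (rule nonint_add_of_int)
  then have "z + of_int m \<notin> \<int>\<^sub>\<le>\<^sub>0" by (auto dest: nonpos_Ints_Int)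
  then have "Gamma (z + of_int m) \<noteq> 0" by (simp add: Gamma_eq_zero_iff)
  then show ?thesis
    using assms zm by (simp add: int_pochhammer_Gamma add.assoc)
qed

definition density_coeff :: "complex \<Rightarrow> int \<Rightarrow> complex \<Rightarrow> complex" where
  "density_coeff s i \<mu> = (- 1) powi i / 2 * (of_int i * (s - 1) - \<mu>)
     * int_pochhammer (1/2 * (1 + \<mu> + s)) i"

lemma coset_nonint:
  assumes "\<xi> \<in> UNIV // cong_2Z" "1 - s \<notin> \<xi>" "\<mu> \<in> \<xi>"
  shows "1/2 * (1 + \<mu> + s) \<notin> \<int>"
proof
  assume "1/2 * (1 + \<mu> + s) \<in> \<int>"
  then obtain k :: int where "1/2 * (1 + \<mu> + s) = of_int k" by (auto elim: Ints_cases)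
  then have "1 - s = \<mu> + 2 * of_int (1 - k)" by (simp add: field_simps)
  then show False using assms cong_2Z_shift[OF assms(1,3)] by metis
qed

text \<open>By the cocycle rule each of the three terms carries the same factor \<open>(-1)^(i + j) P(z, i + j)\<close>, and
  what remains is an identity of polynomials. In the rescaled basis \<open>\<Gamma>(z) v\<^sub>\<mu>\<close> the Pochhammer symbols
  disappear altogether and, up to sign, \<open>L\<^sub>i\<close> has the coefficients \<open>(i (s - 1) - \<mu>)/2\<close> of a tensor
  density module. The relation holds for all integers \<open>i\<close> and \<open>j\<close>, so the full Witt algebra acts.\<close>

lemma density_coeff_bracket:
  assumes "1/2 * (1 + \<mu> + s) \<notin> \<int>"
  shows "of_int (i - j) * density_coeff s (i + j) \<mu> =
    density_coeff s j \<mu> * density_coeff s i (\<mu> + 2 * of_int j)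
      - density_coeff s i \<mu> * density_coeff s j (\<mu> + 2 * of_int i)"
proof -
  define z where "z = 1/2 * (1 + \<mu> + s)"
  define Q where "Q = (- 1) powi (i + j) * int_pochhammer z (i + j)"
  have z: "1/2 * (1 + (\<mu> + 2 * of_int k) + s) = z + of_int k" for k :: int
    by (simp add: z_def field_simps)
  have pow: "(- 1) powi (i + j) = (- 1) powi i * ((- 1) powi j :: complex)"
    by (simp add: power_int_add)
  have Qij: "Q = (- 1) powi j * (- 1) powi i * (int_pochhammer z i * int_pochhammer (z + of_int i) j)"
    using int_pochhammer_add[of z i j] assms by (simp add: Q_def pow z_def)
  have Qji: "Q = (- 1) powi i * (- 1) powi j * (int_pochhammer z j * int_pochhammer (z + of_int j) i)"
    using int_pochhammer_add[of z j i] assms by (simp add: Q_def pow z_def add.commute)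
  have D: "density_coeff s k \<mu> = (- 1) powi k / 2 * (of_int k * (s - 1) - \<mu>) * int_pochhammer z k" for k
    by (simp only: density_coeff_def z_def)
  have D': "density_coeff s k (\<mu> + 2 * of_int l)
      = (- 1) powi k / 2 * (of_int k * (s - 1) - (\<mu> + 2 * of_int l)) * int_pochhammer (z + of_int l) k"
    for k l by (simp only: density_coeff_def z)
  have regroup: "(a / 2 * x * p) * (b / 2 * y * q) = x * y / 4 * (b * a * (p * q))"
    for a b x y p q :: complex by simp
  have "density_coeff s j \<mu> * density_coeff s i (\<mu> + 2 * of_int j) =
      (of_int j * (s - 1) - \<mu>) * (of_int i * (s - 1) - (\<mu> + 2 * of_int j)) / 4 * Q"
    unfolding D D' Qji by (rule regroup)
  moreover have "density_coeff s i \<mu> * density_coeff s j (\<mu> + 2 * of_int i) =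
      (of_int i * (s - 1) - \<mu>) * (of_int j * (s - 1) - (\<mu> + 2 * of_int i)) / 4 * Q"
    unfolding D D' Qij by (rule regroup)
  moreover have "of_int (i - j) * density_coeff s (i + j) \<mu> =
      (of_int (i - j) * ((of_int (i + j) * (s - 1) - \<mu>) / 2)) * Q"
    unfolding D Q_def by simp
  moreover have "of_int (i - j) * ((of_int (i + j) * (s - 1) - \<mu>) / 2) =
      (of_int j * (s - 1) - \<mu>) * (of_int i * (s - 1) - (\<mu> + 2 * of_int j)) / 4
      - (of_int i * (s - 1) - \<mu>) * (of_int j * (s - 1) - (\<mu> + 2 * of_int i)) / 4"
    by (simp add: field_simps)
  ultimately show ?thesis by (simp only: left_diff_distrib)
qed

lemma density_coeff_values:
  assumes "1/2 * (1 + \<mu> + s) \<notin> \<int>"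
  shows "density_coeff s (- 1) \<mu> = 1" "density_coeff s 0 \<mu> = - \<mu> / 2"
    "density_coeff s 1 \<mu> = raising_coeff (s\<^sup>2) \<mu>"
    "8 * (density_coeff s (- 2) \<mu> * raising_coeff (s\<^sup>2) (\<mu> - 2) * raising_coeff (s\<^sup>2) (\<mu> - 4))
      = - 2 * s * (s\<^sup>2 - 1) - (\<mu> - 2) * ((\<mu> - 2)\<^sup>2 - 3 * s\<^sup>2 - 1)"
proof -
  define z where "z = 1/2 * (1 + \<mu> + s)"
  have nz: "z - of_int k \<noteq> 0" for k
    using assms unfolding z_def by (metis Ints_of_int eq_iff_diff_eq_0)
  have nz': "z - 1 \<noteq> 0" "z - 2 \<noteq> 0" using nz[of 1] nz[of 2] by simp_all
  have \<mu>: "\<mu> = 2 * z - 1 - s" by (simp add: z_def field_simps)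
  have P: "int_pochhammer z (- 1) = 1 / (z - 1)" "int_pochhammer z (- 2) = 1 / ((z - 2) * (z - 1))"
    "int_pochhammer z 0 = 1" "int_pochhammer z 1 = z"
    by (simp_all add: int_pochhammer_def numeral_2_eq_2 pochhammer_Suc)
  show "density_coeff s (- 1) \<mu> = 1"
    unfolding density_coeff_def z_def[symmetric] P using nz' by (simp add: \<mu> field_simps)
  show "density_coeff s 0 \<mu> = - \<mu> / 2"
    unfolding density_coeff_def z_def[symmetric] P by simp
  show "density_coeff s 1 \<mu> = raising_coeff (s\<^sup>2) \<mu>"
    unfolding density_coeff_def z_def[symmetric] P raising_coeff_factor by (simp add: \<mu> field_simps)
  have c: "raising_coeff (s\<^sup>2) (\<mu> - 2) = (z - 1 - s) * (z - 1)"
    "raising_coeff (s\<^sup>2) (\<mu> - 4) = (z - 2 - s) * (z - 2)"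
    unfolding raising_coeff_factor by (simp_all add: \<mu> field_simps)
  have d: "density_coeff s (- 2) \<mu> = (- 2 * (s - 1) - \<mu>) / 2 * (1 / ((z - 2) * (z - 1)))"
    unfolding density_coeff_def z_def[symmetric] P by (simp add: power_int_minus)
  have cancel: "x / 2 * (1 / (u * w)) * (p * w) * (q * u) = x / 2 * (p * q)"
    if "u \<noteq> 0" "w \<noteq> 0" for x u w p q :: complex
    using that by simp
  have "8 * (density_coeff s (- 2) \<mu> * raising_coeff (s\<^sup>2) (\<mu> - 2) * raising_coeff (s\<^sup>2) (\<mu> - 4))
      = 4 * ((- 2 * (s - 1) - \<mu>) * ((z - 1 - s) * (z - 2 - s)))"
    unfolding d c cancel[OF nz'(2,1)] by simp
  also have "\<dots> = - 2 * s * (s\<^sup>2 - 1) - (\<mu> - 2) * ((\<mu> - 2)\<^sup>2 - 3 * s\<^sup>2 - 1)"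
    unfolding \<mu> by algebra
  finally show "8 * (density_coeff s (- 2) \<mu> * raising_coeff (s\<^sup>2) (\<mu> - 2) * raising_coeff (s\<^sup>2) (\<mu> - 4))
      = - 2 * s * (s\<^sup>2 - 1) - (\<mu> - 2) * ((\<mu> - 2)\<^sup>2 - 3 * s\<^sup>2 - 1)" .
qed

text \<open>The bilinear extension to all finitely supported functions; \<open>density_act\<close> below is its restriction
  to the carriers.\<close>

definition density_map :: "complex \<Rightarrow> (int \<Rightarrow>\<^sub>0 complex) \<Rightarrow> (complex \<Rightarrow>\<^sub>0 complex) \<Rightarrow> (complex \<Rightarrow>\<^sub>0 complex)"
  where "density_map s x v =
    lin_ext (\<lambda>i. lin_ext (\<lambda>\<mu>. pm_scale (density_coeff s i \<mu>) (dense_v (\<mu> + 2 * of_int i))) v) x"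

definition density_act ::
    "complex \<Rightarrow> complex set \<Rightarrow> (int \<Rightarrow>\<^sub>0 complex) \<Rightarrow> (complex \<Rightarrow>\<^sub>0 complex) \<Rightarrow> (complex \<Rightarrow>\<^sub>0 complex)"
  where "density_act s \<xi> = (\<lambda>x\<in>witt. \<lambda>v\<in>free_space \<xi>. density_map s x v)"

lemma density_map_linear:
  "density_map s (x + y) v = density_map s x v + density_map s y v"
  "density_map s x (v + w) = density_map s x v + density_map s x w"
  "density_map s (pm_scale c x) v = pm_scale c (density_map s x v)"
  "density_map s x (pm_scale c v) = pm_scale c (density_map s x v)"
  "density_map s 0 v = 0" "density_map s x 0 = 0"
  "density_map s (- x) v = - density_map s x v" "density_map s (x - y) v = density_map s x v - density_map s y v"
  by (simp_all add: density_map_def lin_ext_add_fun lin_ext_scale_fun) (simp add: lin_ext_def)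

lemma density_map_basis:
  "density_map s (witt_L i) (dense_v \<mu>) = pm_scale (density_coeff s i \<mu>) (dense_v (\<mu> + 2 * of_int i))"
  by (simp add: density_map_def witt_L_def dense_v_def)

lemma density_map_closed:
  assumes "\<xi> \<in> UNIV // cong_2Z" "v \<in> free_space \<xi>"
  shows "density_map s x v \<in> free_space \<xi>"
  unfolding density_map_def
  by (intro lin_ext_in_free_space[of x UNIV] lin_ext_in_free_space[OF assms(2)]
      pm.subspace_scale[OF subspace_free_space])
    (use cong_2Z_shift[OF assms(1)] in \<open>auto simp: free_space_def dense_v_def\<close>)

lemma density_map_bracket:
  assumes "\<xi> \<in> UNIV // cong_2Z" "1 - s \<notin> \<xi>" "v \<in> free_space \<xi>"
  shows "density_map s (witt_br x y) v
    = density_map s x (density_map s y v) - density_map s y (density_map s x v)"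
proof -
  have "density_map s (witt_br (witt_L i) (witt_L j)) v
      = density_map s (witt_L i) (density_map s (witt_L j) v)
        - density_map s (witt_L j) (density_map s (witt_L i) v)" for i j
    using assms(3)
  proof (induction v rule: free_space_induct)
    case (basis \<mu>)
    have index: "\<mu> + 2 * of_int j + 2 * of_int i = \<mu> + 2 * of_int (i + j)"
      "\<mu> + 2 * of_int i + 2 * of_int j = \<mu> + 2 * of_int (i + j)"
      by simp_all
    have "density_map s (witt_br (witt_L i) (witt_L j)) (dense_v \<mu>)
      = density_map s (witt_L i) (density_map s (witt_L j) (dense_v \<mu>))
        - density_map s (witt_L j) (density_map s (witt_L i) (dense_v \<mu>))"
      using density_coeff_bracket[OF coset_nonint[OF assms(1,2) basis], of i j]
      by (simp only: witt_br_L density_map_linear density_map_basis index pm.scale_scale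
          pm.scale_left_diff_distrib[symmetric])
    then show ?case by (simp add: dense_v_def)
  qed (simp_all add: density_map_linear pm.scale_right_diff_distrib)
  then have "density_map s (witt_br (witt_L i) y) v
      = density_map s (witt_L i) (density_map s y v)
        - density_map s y (density_map s (witt_L i) v)" for i
    by (induction y rule: pm_induct)
      (simp_all add: density_map_linear witt_br_linear witt_L_def pm.scale_right_diff_distrib)
  then show ?thesis
    by (induction x rule: pm_induct)
      (simp_all add: density_map_linear witt_br_linear witt_L_def pm.scale_right_diff_distrib)
qed

lemma density_map_sl2:
  assumes "\<xi> \<in> UNIV // cong_2Z" "1 - s \<notin> \<xi>" "v \<in> free_space \<xi>"
  shows "density_map s (witt_L (- 1)) v = dense_f v"
    "density_map s (witt_L 0) v = pm_scale (- 1 / 2) (dense_h v)"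
    "density_map s (witt_L 1) v = - dense_e (s\<^sup>2) v"
proof -
  have on_basis: "density_map s (witt_L (- 1)) (dense_v \<mu>) = dense_f (dense_v \<mu>) \<and>
    density_map s (witt_L 0) (dense_v \<mu>) = pm_scale (- 1 / 2) (dense_h (dense_v \<mu>)) \<and>
    density_map s (witt_L 1) (dense_v \<mu>) = - dense_e (s\<^sup>2) (dense_v \<mu>)" if "\<mu> \<in> \<xi>" for \<mu>
  proof (intro conjI)
    note coeffs = density_coeff_values[OF coset_nonint[OF assms(1,2) that]]
    show "density_map s (witt_L (- 1)) (dense_v \<mu>) = dense_f (dense_v \<mu>)"
      unfolding density_map_basis coeffs dense_efh_v by simp
    show "density_map s (witt_L 0) (dense_v \<mu>) = pm_scale (- 1 / 2) (dense_h (dense_v \<mu>))"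
      unfolding density_map_basis coeffs dense_efh_v by simp
    have "raising_coeff (s\<^sup>2) \<mu> = - (1/4 * (s\<^sup>2 - (\<mu> + 1)\<^sup>2))"
      by (simp add: raising_coeff_def field_simps)
    then show "density_map s (witt_L 1) (dense_v \<mu>) = - dense_e (s\<^sup>2) (dense_v \<mu>)"
      unfolding density_map_basis coeffs dense_efh_v by (simp only: pm.scale_minus_left) simp
  qed
  have "density_map s (witt_L (- 1)) v = dense_f v \<and>
    density_map s (witt_L 0) v = pm_scale (- 1 / 2) (dense_h v) \<and>
    density_map s (witt_L 1) v = - dense_e (s\<^sup>2) v"
    using assms(3)
  proof (induction v rule: free_space_induct)
    case zero
    show ?case by (simp add: density_map_linear dense_efh_def)
  next
    case (basis \<mu>)
    then show ?case using on_basis[of \<mu>] by (simp add: dense_v_def)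
  qed (simp_all add: density_map_linear dense_linear pm.scale_right_distrib mult.commute)
  then show "density_map s (witt_L (- 1)) v = dense_f v"
    "density_map s (witt_L 0) v = pm_scale (- 1 / 2) (dense_h v)"
    "density_map s (witt_L 1) v = - dense_e (s\<^sup>2) v" by auto
qed

lemma density_act_compatible:
  assumes "\<xi> \<in> UNIV // cong_2Z" "1 - s \<notin> \<xi>"
  shows "compatible_structure \<xi> (s\<^sup>2) (density_act s \<xi>)"
proof -
  interpret lie_algebra_on pm_scale witt witt_br by (rule lie_algebra_witt)
  note V_closed = pm.subspace_add[OF subspace_free_space] pm.subspace_scale[OF subspace_free_space]
  note g_closed = pm.subspace_add[OF lie_subspace] pm.subspace_scale[OF lie_subspace]
  have "lie_module_on pm_scale witt witt_br pm_scale (free_space \<xi>) (density_act s \<xi>)"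
  proof
    show "pm.subspace (free_space \<xi>)" by (rule subspace_free_space)
    show "density_act s \<xi> \<in> witt \<rightarrow>\<^sub>E free_space \<xi> \<rightarrow>\<^sub>E free_space \<xi>"
      using density_map_closed[OF assms(1)] by (auto simp: density_act_def)
  qed (use assms in \<open>simp_all add: density_act_def V_closed g_closed br_closed density_map_linear
      density_map_closed density_map_bracket\<close>)
  moreover have "density_act s \<xi> (sl2_to_witt A) v = dense_act \<xi> (s\<^sup>2) A v"
    if "A \<in> sl2" "v \<in> free_space \<xi>" for A v
    using that
    by (simp add: density_act_def dense_act_def sl2_to_witt_in_witt)
      (simp add: sl2_to_witt_def density_map_linear density_map_sl2[OF assms])
  ultimately show ?thesis
    using assms(1) by (simp add: compatible_structure_def compatible_witt_structures_def)
qed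

lemma density_act_basis:
  assumes "i \<le> 1" "\<mu> \<in> \<xi>"
  shows "density_act s \<xi> (witt_L i) (dense_v \<mu>)
    = pm_scale (density_coeff s i \<mu>) (dense_v (\<mu> + 2 * of_int i))"
  using assms by (simp add: density_act_def density_map_basis)

lemma kappa_density_act:
  assumes "\<xi> \<in> UNIV // cong_2Z" "1 - s \<notin> \<xi>" "\<mu> \<in> \<xi>"
  shows "kappa (s\<^sup>2) (density_act s \<xi>) \<mu> = - 2 * s * (s\<^sup>2 - 1)"
proof -
  have "witt_coeff (density_act s \<xi>) (- 2) \<mu> = density_coeff s (- 2) \<mu>"
    using density_act_basis[of "- 2" \<mu> \<xi> s] assms(3) by (simp add: witt_coeff_def) (simp add: dense_v_def)
  then show ?thesis
    using density_coeff_values(4)[OF coset_nonint[OF assms]] by (simp add: kappa_def)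
qed


section \<open>Simple dense modules\<close>

text \<open>If \<open>e v\<^sub>\<mu> = 0\<close>, then the span of the \<open>v\<close> at \<open>\<mu>, \<mu> - 2, \<mu> - 4, \<dots>\<close> is a submodule, and
  it is proper because it misses \<open>v\<close> at \<open>\<mu> + 2\<close>.\<close>

lemma simple_dense_raising_coeff:
  assumes "\<xi> \<in> UNIV // cong_2Z" "simple_dense \<xi> \<tau>" "\<mu> \<in> \<xi>"
  shows "raising_coeff \<tau> \<mu> \<noteq> 0"
proof
  assume zero: "raising_coeff \<tau> \<mu> = 0"
  define W where "W = free_space {\<mu> - 2 * of_nat k | k. True}"
  interpret simple_lie_module_on mat_scale sl2 sl2_br pm_scale "free_space \<xi>" "dense_act \<xi> \<tau>"
    using assms(2) by (simp add: simple_dense_def)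
  have sub: "{\<mu> - 2 * of_nat k | k. True} \<subseteq> \<xi>"
  proof clarify
    fix k :: nat
    show "\<mu> - 2 * of_nat k \<in> \<xi>" using cong_2Z_shift[OF assms(1,3), of "- int k"] by simp
  qed
  have WV: "W \<subseteq> free_space \<xi>" using sub by (auto simp: W_def free_space_def)
  note W_sub = subspace_free_space[of "{\<mu> - 2 * of_nat k | k. True}", folded W_def]
  have v_W: "dense_v (\<mu> - 2 * of_nat k) \<in> W" for k by (auto simp: W_def)
  have "dense_e \<tau> w \<in> W" if "w \<in> W" for w
    unfolding dense_e_def W_def
  proof (rule lin_ext_in_free_space[OF that[unfolded W_def]], fold W_def, clarify)
    fix k :: nat
    show "pm_scale (1/4 * (\<tau> - (\<mu> - 2 * of_nat k + 1)\<^sup>2)) (dense_v (\<mu> - 2 * of_nat k + 2)) \<in> W"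
    proof (cases k)
      case 0
      then show ?thesis using zero by (simp add: raising_coeff_def pm.subspace_0[OF W_sub])
    next
      case (Suc m)
      then have "\<mu> - 2 * of_nat k + 2 = \<mu> - 2 * of_nat m" by simp
      then show ?thesis by (simp only: pm.subspace_scale[OF W_sub v_W])
    qed
  qed
  moreover have "dense_f w \<in> W" if "w \<in> W" for w
    unfolding dense_f_def W_def
  proof (rule lin_ext_in_free_space[OF that[unfolded W_def]], fold W_def, clarify)
    fix k :: nat
    have "\<mu> - 2 * of_nat k - 2 = \<mu> - 2 * of_nat (Suc k)" by simp
    then show "dense_v (\<mu> - 2 * of_nat k - 2) \<in> W" by (simp only: v_W)
  qed
  moreover have "dense_h w \<in> W" if "w \<in> W" for w
    using that by (auto simp: W_def free_space_iff lookup_dense_h)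
  ultimately have "dense_act \<xi> \<tau> A w \<in> W" if "A \<in> sl2" "w \<in> W" for A w
    using that WV by (auto simp: dense_act_def intro!: pm.subspace_add[OF W_sub] pm.subspace_scale[OF W_sub])
  then consider "W = {0}" | "W = free_space \<xi>"
    using submodule_trivial[OF W_sub WV] by blast
  then show False
  proof cases
    case 1
    then have "dense_v \<mu> = 0" using v_W[of 0] by simp
    then show False by (metis dense_v_def lookup_single_eq lookup_zero zero_neq_one)
  next
    case 2
    then have "dense_v (\<mu> + 2) \<in> W" using cong_2Z_shift_numeral[OF assms(1,3)] by simp
    then obtain k :: nat where "\<mu> + 2 = \<mu> - 2 * of_nat k" by (auto simp: W_def)
    then have "(of_nat (2 * k + 2) :: complex) = 0" by (simp add: algebra_simps)
    then show False by (simp only: of_nat_eq_0_iff)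
  qed
qed

text \<open>The structures are classified by \<open>\<kappa>\<close>, whose two possible values are attained by the parameters
  \<open>s\<close> and \<open>-s\<close>.\<close>

lemma card_compatible_simple:
  assumes coset: "\<xi> \<in> UNIV // cong_2Z" and simple: "simple_dense \<xi> (s\<^sup>2)"
  shows "card (compatible_witt_structures \<xi> (s\<^sup>2)) = (if s * (s\<^sup>2 - 1) = 0 then 1 else 2)"
proof -
  have nonzero: "raising_coeff (s\<^sup>2) \<mu> \<noteq> 0" if "\<mu> \<in> \<xi>" for \<mu>
    using simple_dense_raising_coeff[OF coset simple that] .
  have roots: "1 - s \<notin> \<xi>" "1 - (- s) \<notin> \<xi>"
    using nonzero[OF cong_2Z_shift_numeral(2)[OF coset, of "1 - s"]]
      nonzero[OF cong_2Z_shift_numeral(2)[OF coset, of "1 - (- s)"]]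
    by (auto simp: raising_coeff_factor)
  obtain \<mu> where \<mu>: "\<mu> \<in> \<xi>" using cong_2Z_nonempty[OF coset] by blast
  have compat: "compatible_structure \<xi> (s\<^sup>2) (density_act s \<xi>)"
    "compatible_structure \<xi> (s\<^sup>2) (density_act (- s) \<xi>)"
    using density_act_compatible[OF coset roots(1)] density_act_compatible[OF coset roots(2)] by simp_all
  have kappas: "kappa (s\<^sup>2) (density_act s \<xi>) \<mu> = - 2 * s * (s\<^sup>2 - 1)"
    "kappa (s\<^sup>2) (density_act (- s) \<xi>) \<mu> = 2 * s * (s\<^sup>2 - 1)"
    using kappa_density_act[OF coset roots(1) \<mu>] kappa_density_act[OF coset roots(2) \<mu>] by simp_all
  have "\<rho> = density_act s \<xi> \<or> \<rho> = density_act (- s) \<xi>"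
    if "\<rho> \<in> compatible_witt_structures \<xi> (s\<^sup>2)" for \<rho>
  proof -
    interpret compatible_structure \<xi> "s\<^sup>2" \<rho>
      using coset that by (simp add: compatible_structure_def)
    have "(kappa (s\<^sup>2) \<rho> \<mu>)\<^sup>2 = (2 * s * (s\<^sup>2 - 1))\<^sup>2"
      using kappa_squared[OF \<mu>] by (simp add: power_mult_distrib)
    then have "kappa (s\<^sup>2) \<rho> \<mu> = 2 * s * (s\<^sup>2 - 1) \<or> kappa (s\<^sup>2) \<rho> \<mu> = - 2 * s * (s\<^sup>2 - 1)"
      by (simp add: power2_eq_iff)
    then show ?thesis
      using compatible_structure_eqI_kappa[OF compatible_structure_axioms _ nonzero \<mu>] compat kappas
      by metis
  qed
  then have set: "compatible_witt_structures \<xi> (s\<^sup>2) = {density_act s \<xi>, density_act (- s) \<xi>}"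
    using compat by (auto simp: compatible_structure_def)
  have "density_act s \<xi> = density_act (- s) \<xi> \<longleftrightarrow> s * (s\<^sup>2 - 1) = 0"
  proof
    assume "density_act s \<xi> = density_act (- s) \<xi>"
    then show "s * (s\<^sup>2 - 1) = 0" using kappas by simp
  next
    assume "s * (s\<^sup>2 - 1) = 0"
    then show "density_act s \<xi> = density_act (- s) \<xi>"
      using compatible_structure_eqI_kappa[OF compat nonzero \<mu>] kappas by simp
  qed
  then show ?thesis unfolding set by (simp add: card_insert_if)
qed

theorem proposition4p8:
  fixes \<xi> :: "complex set" and \<tau> s :: complex
  assumes "\<xi> \<in> UNIV // cong_2Z"
    and "s\<^sup>2 = \<tau>"
  shows "(compatible_witt_structures \<xi> \<tau> = {} \<longleftrightarrow> {x. (x - 1)\<^sup>2 - \<tau> = 0} \<subseteq> \<xi>)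
    \<and> {x. (x - 1)\<^sup>2 - \<tau> = 0} = {1 + s, 1 - s}
    \<and> (\<forall>\<epsilon>\<in>{1, - 1}. 1 - \<epsilon> * s \<notin> \<xi> \<longrightarrow>
        (\<exists>!\<rho>. \<rho> \<in> compatible_witt_structures \<xi> \<tau> \<and>
          (\<forall>i\<le>1. \<forall>\<mu>\<in>\<xi>. \<rho> (witt_L i) (dense_v \<mu>) =
            pm_scale ((- 1) powi i / 2 * (of_int i * (\<epsilon> * s - 1) - \<mu>)
                * int_pochhammer (1/2 * (1 + \<mu> + \<epsilon> * s)) i)
              (dense_v (\<mu> + 2 * of_int i)))))
    \<and> (simple_dense \<xi> \<tau> \<longrightarrow>
        (\<tau> \<noteq> 0 \<and> \<tau> \<noteq> 1 \<longrightarrow> card (compatible_witt_structures \<xi> \<tau>) = 2) \<and>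
        (\<tau> = 0 \<or> \<tau> = 1 \<longrightarrow> card (compatible_witt_structures \<xi> \<tau>) = 1))"
proof -
  have roots: "{x. (x - 1)\<^sup>2 - \<tau> = 0} = {1 + s, 1 - s}"
    using assms(2) by (auto simp: power2_eq_iff algebra_simps)
  have compat: "compatible_structure \<xi> \<tau> (density_act (\<epsilon> * s) \<xi>)"
    if "\<epsilon> \<in> {1, - 1}" "1 - \<epsilon> * s \<notin> \<xi>" for \<epsilon>
    using density_act_compatible[OF assms(1) that(2)] that(1) assms(2) by auto
  have "compatible_witt_structures \<xi> \<tau> = {} \<longleftrightarrow> {1 + s, 1 - s} \<subseteq> \<xi>"
  proof
    assume "compatible_witt_structures \<xi> \<tau> = {}"
    then show "{1 + s, 1 - s} \<subseteq> \<xi>"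
      using compat[of 1] compat[of "- 1"] by (auto simp: compatible_structure_def)
  next
    assume "{1 + s, 1 - s} \<subseteq> \<xi>"
    then show "compatible_witt_structures \<xi> \<tau> = {}"
      using no_compatible_structure[of \<xi> s] assms by (auto simp: compatible_structure_def)
  qed
  moreover have "\<exists>!\<rho>. \<rho> \<in> compatible_witt_structures \<xi> \<tau> \<and>
      (\<forall>i\<le>1. \<forall>\<mu>\<in>\<xi>. \<rho> (witt_L i) (dense_v \<mu>) =
        pm_scale (density_coeff (\<epsilon> * s) i \<mu>) (dense_v (\<mu> + 2 * of_int i)))"
    if "\<epsilon> \<in> {1, - 1}" "1 - \<epsilon> * s \<notin> \<xi>" for \<epsilon>
  proof (rule ex1I[of _ "density_act (\<epsilon> * s) \<xi>"], goal_cases)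
    case 1
    then show ?case
      using compat[OF that] density_act_basis by (auto simp: compatible_structure_def)
  next
    case (2 \<rho>)
    show ?case
    proof (rule compatible_structure_eqI[OF _ compat[OF that]])
      show "compatible_structure \<xi> \<tau> \<rho>" using 2 assms(1) by (simp add: compatible_structure_def)
      show "witt_coeff \<rho> (- 2) \<mu> = witt_coeff (density_act (\<epsilon> * s) \<xi>) (- 2) \<mu>" if "\<mu> \<in> \<xi>" for \<mu>
        using 2 that density_act_basis[of "- 2" \<mu> \<xi> "\<epsilon> * s"] by (simp add: witt_coeff_def)
    qed
  qed
  moreover have "card (compatible_witt_structures \<xi> \<tau>) = (if \<tau> = 0 \<or> \<tau> = 1 then 1 else 2)"
    if "simple_dense \<xi> \<tau>"
    using card_compatible_simple[of \<xi> s] that assms by (auto split: if_splits)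
  ultimately show ?thesis
    unfolding roots by (simp add: density_coeff_def)
qed

end
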